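(* Let $K$ be a field and $E$ a graph. (1) If $\mathrm{char}(K)=2$, then $\mathbf{S}_{L_K(E)}$ is Jordan solvable if and only if $E$ is a disjoint union of graphs of types $E_1,\dots,E_6$, and $\mathbf{S}_{L_K(E)}$ is Jordan nilpotent if and only if $E$ is a disjoint union of graphs of types $E_1$ and $E_2$. (2) If $\mathrm{char}(K)\ne 2$ and $E$ has at least one vertex, then $\mathbf{S}_{L_K(E)}$ is not Jordan nilpotent.
   Context: Graphs (with $I,J$ nonempty index sets of arbitrary cardinality): $E_1$: a single vertex, no edges. $E_2$: a single vertex with one loop. $E_3$: two distinct vertices $a,b$ with exactly one edge $a\to b$ and one edge $b\to a$. $E_4$: a vertex $u$ and distinct vertices $u_i$ ($i\in I$), exactly one edge $u\to u_i$ for each $i$, no other edges. $E_5$: a vertex $v$ and distinct vertices $v_j$ ($j\in J$), one edge $v\to v_j$ and one loop at $v_j$ for each $j$, no other edges. $E_6$: a vertex $w$, distinct vertices $u_i$ ($i\in I$) and $v_j$ ($j\in J$), one edge $w\to u_i$ for each $i$, one edge $w\to v_j$ and one loop at $v_j$ for each $j$, no other edges. "Disjoint union of graphs of the listed types" means every connected component is isomorphic to one of them. $L_K(E)$ is the Leavitt path algebra: the free $K$-algebra generated by $E^0\cup E^1\cup\{e^*:e\in E^1\}$ subject to $vv'=\delta_{v,v'}v$; $s(e)e=er(e)=e$; $r(e)e^*=e^*s(e)=e^*$; $e^*f=\delta_{e,f}r(e)$; $v=\sum_{s(e)=v}ee^*$ for every vertex $v$ emitting finitely many and at least one edge. The standard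 involution ${}^\star$ is the $K$-linear involution with $v^\star=v$, $e^\star=e^*$, $(e^* )^\star=e$; $\mathbf{S}_{L_K(E)}=\{x\in L_K(E): x^\star=x\}$, a Jordan subalgebra under $a\circ b=ab+ba$. For subspaces, $S\circ T=\mathrm{span}_K\{ab+ba:a\in S,b\in T\}$. For a Jordan subalgebra $\mathcal{J}$: $\mathcal{J}_{(0)}=\mathcal{J}$, $\mathcal{J}_{(n)}=\mathcal{J}_{(n-1)}\circ\mathcal{J}_{(n-1)}$; $\mathcal{J}_0=\mathcal{J}$, $\mathcal{J}_n=\mathcal{J}_{n-1}\circ\mathcal{J}$. $\mathcal{J}$ is Jordan solvable (resp. nilpotent) if $\mathcal{J}_{(n)}=0$ (resp. $\mathcal{J}_n=0$) for some $n\ge0$. *)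

theory Defs
  imports Main "HOL-Library.Poly_Mapping"
begin

definition graph :: "'v set \<Rightarrow> 'e set \<Rightarrow> ('e \<Rightarrow> 'v) \<Rightarrow> ('e \<Rightarrow> 'v) \<Rightarrow> bool" where
  "graph V Ed s r \<longleftrightarrow> (\<forall>e\<in>Ed. s e \<in> V \<and> r e \<in> V)"

datatype ('v, 'e) gen = GV 'v | GE 'e | GS 'e

type_synonym ('v, 'e, 'k) falg = "('v, 'e) gen list \<Rightarrow>\<^sub>0 'k"

definition gens :: "'v set \<Rightarrow> 'e set \<Rightarrow> ('v, 'e) gen set" where
  "gens V Ed = GV ` V \<union> GE ` Ed \<union> GS ` Ed"

text \<open>Elements of the free non-unital K-algebra on the generators: finite K-linear
  combinations of nonempty words in the generators.\<close>
definition free_alg :: "'v set \<Rightarrow> 'e set \<Rightarrow> ('v, 'e, 'k::field) falg set" where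
  "free_alg V Ed = {p. \<forall>w\<in>Poly_Mapping.keys p. w \<noteq> [] \<and> set w \<subseteq> gens V Ed}"

definition fmul :: "('v, 'e, 'k::field) falg \<Rightarrow> ('v, 'e, 'k) falg \<Rightarrow> ('v, 'e, 'k) falg" where
  "fmul p q = (\<Sum>u\<in>Poly_Mapping.keys p. \<Sum>v\<in>Poly_Mapping.keys q. Poly_Mapping.single (u @ v) (Poly_Mapping.lookup p u * Poly_Mapping.lookup q v))"

definition smul :: "'k::field \<Rightarrow> ('v, 'e, 'k) falg \<Rightarrow> ('v, 'e, 'k) falg" where
  "smul c p = fmul (Poly_Mapping.single [] c) p"

definition gen1 :: "('v, 'e) gen \<Rightarrow> ('v, 'e, 'k::field) falg" where
  "gen1 g = Poly_Mapping.single [g] 1"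

definition lpa_rels :: "'v set \<Rightarrow> 'e set \<Rightarrow> ('e \<Rightarrow> 'v) \<Rightarrow> ('e \<Rightarrow> 'v) \<Rightarrow> ('v, 'e, 'k::field) falg set" where
  "lpa_rels V Ed s r =
     {fmul (gen1 (GV v)) (gen1 (GV v')) - (if v = v' then gen1 (GV v) else 0) | v v'. v \<in> V \<and> v' \<in> V}
   \<union> {fmul (gen1 (GV (s e))) (gen1 (GE e)) - gen1 (GE e) | e. e \<in> Ed}
   \<union> {fmul (gen1 (GE e)) (gen1 (GV (r e))) - gen1 (GE e) | e. e \<in> Ed}
   \<union> {fmul (gen1 (GV (r e))) (gen1 (GS e)) - gen1 (GS e) | e. e \<in> Ed}
   \<union> {fmul (gen1 (GS e)) (gen1 (GV (s e))) - gen1 (GS e) | e. e \<in> Ed}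
   \<union> {fmul (gen1 (GS e)) (gen1 (GE f)) - (if e = f then gen1 (GV (r e)) else 0) | e f. e \<in> Ed \<and> f \<in> Ed}
   \<union> {gen1 (GV v) - (\<Sum>e\<in>{e\<in>Ed. s e = v}. fmul (gen1 (GE e)) (gen1 (GS e))) | v.
        v \<in> V \<and> finite {e\<in>Ed. s e = v} \<and> {e\<in>Ed. s e = v} \<noteq> {}}"

text \<open>The two-sided ideal of the free algebra generated by the relations;
  L_K(E) is the quotient free_alg / lpa_ideal.\<close>
inductive_set lpa_ideal :: "'v set \<Rightarrow> 'e set \<Rightarrow> ('e \<Rightarrow> 'v) \<Rightarrow> ('e \<Rightarrow> 'v) \<Rightarrow> ('v, 'e, 'k::field) falg set"
  for V Ed s r where
  rel: "x \<in> lpa_rels V Ed s r \<Longrightarrow> x \<in> lpa_ideal V Ed s r"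
| zero: "0 \<in> lpa_ideal V Ed s r"
| add: "x \<in> lpa_ideal V Ed s r \<Longrightarrow> y \<in> lpa_ideal V Ed s r \<Longrightarrow> x + y \<in> lpa_ideal V Ed s r"
| smul: "x \<in> lpa_ideal V Ed s r \<Longrightarrow> smul c x \<in> lpa_ideal V Ed s r"
| mult_left: "a \<in> free_alg V Ed \<Longrightarrow> x \<in> lpa_ideal V Ed s r \<Longrightarrow> fmul a x \<in> lpa_ideal V Ed s r"
| mult_right: "a \<in> free_alg V Ed \<Longrightarrow> x \<in> lpa_ideal V Ed s r \<Longrightarrow> fmul x a \<in> lpa_ideal V Ed s r"

fun gstar :: "('v, 'e) gen \<Rightarrow> ('v, 'e) gen" where
  "gstar (GV v) = GV v"
| "gstar (GE e) = GS e"
| "gstar (GS e) = GE e"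

definition fstar :: "('v, 'e, 'k::field) falg \<Rightarrow> ('v, 'e, 'k) falg" where
  "fstar p = (\<Sum>w\<in>Poly_Mapping.keys p. Poly_Mapping.single (rev (map gstar w)) (Poly_Mapping.lookup p w))"

text \<open>Subspaces of L_K(E) are represented by their preimages in the free algebra
  (subspaces containing the ideal).  The symmetric elements:\<close>
definition lpa_sym :: "'v set \<Rightarrow> 'e set \<Rightarrow> ('e \<Rightarrow> 'v) \<Rightarrow> ('e \<Rightarrow> 'v) \<Rightarrow> ('v, 'e, 'k::field) falg set" where
  "lpa_sym V Ed s r = {x \<in> free_alg V Ed. fstar x - x \<in> lpa_ideal V Ed s r}"

inductive_set kspan :: "('v, 'e, 'k::field) falg set \<Rightarrow> ('v, 'e, 'k) falg set" for X where
  zero: "0 \<in> kspan X"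
| base: "x \<in> X \<Longrightarrow> smul c x \<in> kspan X"
| add: "x \<in> kspan X \<Longrightarrow> y \<in> kspan X \<Longrightarrow> x + y \<in> kspan X"

text \<open>Preimage of S o T in the quotient: span of the Jordan products plus the ideal.\<close>
definition jcirc :: "('v, 'e, 'k::field) falg set \<Rightarrow> ('v, 'e, 'k) falg set \<Rightarrow> ('v, 'e, 'k) falg set
   \<Rightarrow> ('v, 'e, 'k) falg set" where
  "jcirc I S T = kspan ({fmul a b + fmul b a | a b. a \<in> S \<and> b \<in> T} \<union> I)"

fun jderived :: "('v, 'e, 'k::field) falg set \<Rightarrow> ('v, 'e, 'k) falg set \<Rightarrow> nat \<Rightarrow> ('v, 'e, 'k) falg set" where
  "jderived I J 0 = J"
| "jderived I J (Suc n) = jcirc I (jderived I J n) (jderived I J n)"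

fun jlower :: "('v, 'e, 'k::field) falg set \<Rightarrow> ('v, 'e, 'k) falg set \<Rightarrow> nat \<Rightarrow> ('v, 'e, 'k) falg set" where
  "jlower I J 0 = J"
| "jlower I J (Suc n) = jcirc I (jlower I J n) J"

text \<open>A subspace is zero in the quotient iff its preimage lies in the ideal.\<close>
definition lpa_sym_jordan_solvable :: "'v set \<Rightarrow> 'e set \<Rightarrow> ('e \<Rightarrow> 'v) \<Rightarrow> ('e \<Rightarrow> 'v) \<Rightarrow> 'k::field itself \<Rightarrow> bool" where
  "lpa_sym_jordan_solvable V Ed s r (_::'k itself) \<longleftrightarrow>
     (\<exists>n. jderived (lpa_ideal V Ed s r) (lpa_sym V Ed s r :: ('v, 'e, 'k) falg set) n \<subseteq> lpa_ideal V Ed s r)"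

definition lpa_sym_jordan_nilpotent :: "'v set \<Rightarrow> 'e set \<Rightarrow> ('e \<Rightarrow> 'v) \<Rightarrow> ('e \<Rightarrow> 'v) \<Rightarrow> 'k::field itself \<Rightarrow> bool" where
  "lpa_sym_jordan_nilpotent V Ed s r (_::'k itself) \<longleftrightarrow>
     (\<exists>n. jlower (lpa_ideal V Ed s r) (lpa_sym V Ed s r :: ('v, 'e, 'k) falg set) n \<subseteq> lpa_ideal V Ed s r)"

definition adj :: "'e set \<Rightarrow> ('e \<Rightarrow> 'v) \<Rightarrow> ('e \<Rightarrow> 'v) \<Rightarrow> ('v \<times> 'v) set" where
  "adj Ed s r = {(s e, r e) | e. e \<in> Ed} \<union> {(r e, s e) | e. e \<in> Ed}"

definition component :: "'v set \<Rightarrow> 'e set \<Rightarrow> ('e \<Rightarrow> 'v) \<Rightarrow> ('e \<Rightarrow> 'v) \<Rightarrow> 'v \<Rightarrow> 'v set" where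
  "component V Ed s r v = {w \<in> V. (v, w) \<in> (adj Ed s r)\<^sup>*}"

definition comp_edges :: "'e set \<Rightarrow> ('e \<Rightarrow> 'v) \<Rightarrow> 'v set \<Rightarrow> 'e set" where
  "comp_edges Ed s C = {e \<in> Ed. s e \<in> C}"

definition is_E1 :: "'v set \<Rightarrow> 'e set \<Rightarrow> ('e \<Rightarrow> 'v) \<Rightarrow> ('e \<Rightarrow> 'v) \<Rightarrow> bool" where
  "is_E1 C EC s r \<longleftrightarrow> (\<exists>a. C = {a}) \<and> EC = {}"

definition is_E2 :: "'v set \<Rightarrow> 'e set \<Rightarrow> ('e \<Rightarrow> 'v) \<Rightarrow> ('e \<Rightarrow> 'v) \<Rightarrow> bool" where
  "is_E2 C EC s r \<longleftrightarrow> (\<exists>a e. C = {a} \<and> EC = {e} \<and> s e = a \<and> r e = a)"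

definition is_E3 :: "'v set \<Rightarrow> 'e set \<Rightarrow> ('e \<Rightarrow> 'v) \<Rightarrow> ('e \<Rightarrow> 'v) \<Rightarrow> bool" where
  "is_E3 C EC s r \<longleftrightarrow> (\<exists>a b e f. a \<noteq> b \<and> C = {a, b} \<and> EC = {e, f} \<and>
       s e = a \<and> r e = b \<and> s f = b \<and> r f = a)"

definition is_hub :: "'v set \<Rightarrow> 'e set \<Rightarrow> ('e \<Rightarrow> 'v) \<Rightarrow> ('e \<Rightarrow> 'v) \<Rightarrow> 'v \<Rightarrow> 'v set \<Rightarrow> 'v set \<Rightarrow> bool" where
  "is_hub C EC s r w U Vs \<longleftrightarrow>
     C = insert w (U \<union> Vs) \<and> w \<notin> U \<and> w \<notin> Vs \<and> U \<inter> Vs = {} \<and>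
     (\<forall>e\<in>EC. (s e = w \<and> r e \<in> U \<union> Vs) \<or> (s e = r e \<and> s e \<in> Vs)) \<and>
     (\<forall>x\<in>U \<union> Vs. \<exists>!e. e \<in> EC \<and> s e = w \<and> r e = x) \<and>
     (\<forall>y\<in>Vs. \<exists>!e. e \<in> EC \<and> s e = y \<and> r e = y)"

definition is_E4 :: "'v set \<Rightarrow> 'e set \<Rightarrow> ('e \<Rightarrow> 'v) \<Rightarrow> ('e \<Rightarrow> 'v) \<Rightarrow> bool" where
  "is_E4 C EC s r \<longleftrightarrow> (\<exists>w U. U \<noteq> {} \<and> is_hub C EC s r w U {})"

definition is_E5 :: "'v set \<Rightarrow> 'e set \<Rightarrow> ('e \<Rightarrow> 'v) \<Rightarrow> ('e \<Rightarrow> 'v) \<Rightarrow> bool" where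
  "is_E5 C EC s r \<longleftrightarrow> (\<exists>w Vs. Vs \<noteq> {} \<and> is_hub C EC s r w {} Vs)"

definition is_E6 :: "'v set \<Rightarrow> 'e set \<Rightarrow> ('e \<Rightarrow> 'v) \<Rightarrow> ('e \<Rightarrow> 'v) \<Rightarrow> bool" where
  "is_E6 C EC s r \<longleftrightarrow> (\<exists>w U Vs. U \<noteq> {} \<and> Vs \<noteq> {} \<and> is_hub C EC s r w U Vs)"

definition components_all :: "('v set \<Rightarrow> 'e set \<Rightarrow> ('e \<Rightarrow> 'v) \<Rightarrow> ('e \<Rightarrow> 'v) \<Rightarrow> bool)
   \<Rightarrow> 'v set \<Rightarrow> 'e set \<Rightarrow> ('e \<Rightarrow> 'v) \<Rightarrow> ('e \<Rightarrow> 'v) \<Rightarrow> bool" where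
  "components_all P V Ed s r \<longleftrightarrow>
     (\<forall>v\<in>V. P (component V Ed s r v) (comp_edges Ed s (component V Ed s r v)) s r)"

definition union_E1_to_E6 :: "'v set \<Rightarrow> 'e set \<Rightarrow> ('e \<Rightarrow> 'v) \<Rightarrow> ('e \<Rightarrow> 'v) \<Rightarrow> bool" where
  "union_E1_to_E6 = components_all (\<lambda>C EC s r. is_E1 C EC s r \<or> is_E2 C EC s r \<or> is_E3 C EC s r
      \<or> is_E4 C EC s r \<or> is_E5 C EC s r \<or> is_E6 C EC s r)"

definition union_E1_E2 :: "'v set \<Rightarrow> 'e set \<Rightarrow> ('e \<Rightarrow> 'v) \<Rightarrow> ('e \<Rightarrow> 'v) \<Rightarrow> bool" where
  "union_E1_E2 = components_all (\<lambda>C EC s r. is_E1 C EC s r \<or> is_E2 C EC s r)"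

end

theory Submission
  imports Defs
begin

text \<open>If some vertex of \<open>E\<close> is the range of three pairwise prefix-incomparable paths
  \<open>p\<^sub>1, p\<^sub>2, p\<^sub>3\<close>, the elements \<open>p\<^sub>i p\<^sub>j\<^sup>* + p\<^sub>j p\<^sub>i\<^sup>*\<close> reproduce one another under the Jordan
  product in characteristic 2; they are nonzero because every vertex acts nontrivially on a suitable
  module. Excluding such triples of paths leaves exactly the graphs \<open>E\<^sub>1, \<dots>, E\<^sub>6\<close>.

  Conversely, for these graphs \<open>L\<^sub>K(E)\<close> is spanned by hub vertices and by elements
  \<open>\<alpha> \<rho> \<beta>\<^sup>*\<close>, where \<open>\<rho>\<close> lies in a commutative corner ring at a vertex \<open>x\<close> and \<open>\<alpha>, \<beta>\<close> are \<open>x\<close> or the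
  unique edge into \<open>x\<close> from elsewhere. These multiply like \<open>2 \<times> 2\<close> matrix units, and in
  characteristic 2 the Lie algebra of \<open>2 \<times> 2\<close> matrices over a commutative ring is solvable of length
  three: brackets have trace zero, brackets of those are scalar. So the whole of \<open>L\<^sub>K(E)\<close>, and not
  only its symmetric part, is Jordan solvable.

  For nilpotency, a non-loop edge \<open>e\<close> gives \<open>(e + e\<^sup>*) \<circ> r(e) = e + e\<^sup>*\<close>, and in characteristic other
  than 2 already \<open>v \<circ> v = 2 v\<close> is fatal.\<close>

section \<open>The free algebra as a ring\<close>

text \<open>The product of \<open>Poly_Mapping\<close> is convolution over an additive monoid of
  exponents, so concatenation of words has to serve as their addition. Then \<open>fmul\<close> is
  the ring product and the ring laws become available.\<close>

instantiation list :: (type) monoid_add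
begin
definition zero_list_def: "0 = ([] :: 'a list)"
definition plus_list_def: "u + v = (u @ v :: 'a list)"
instance by standard (simp_all add: zero_list_def plus_list_def)
end

lemma sum_single_lookup: "(\<Sum>w\<in>Poly_Mapping.keys p. Poly_Mapping.single w (Poly_Mapping.lookup p w)) = p"
  by (rule poly_mapping_eqI) (simp add: lookup_sum lookup_single when_def in_keys_iff)

lemma fmul_eq_times: "fmul p q = p * q"
proof -
  have "p * q = (\<Sum>u\<in>Poly_Mapping.keys p. Poly_Mapping.single u (Poly_Mapping.lookup p u))
     * (\<Sum>v\<in>Poly_Mapping.keys q. Poly_Mapping.single v (Poly_Mapping.lookup q v))"
    by (simp add: sum_single_lookup)
  also have "\<dots> = fmul p q"
    unfolding fmul_def sum_product by (simp add: mult_single plus_list_def)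
  finally show ?thesis by simp
qed

lemma single_Nil_one: "Poly_Mapping.single [] 1 = 1"
  using single_one[where ?'a = "'a list"] by (simp only: zero_list_def)

lemma smul_single: "smul c (Poly_Mapping.single w d) = Poly_Mapping.single w (c * d)"
  by (simp add: smul_def fmul_eq_times mult_single plus_list_def)

lemma smul_add: "smul c (p + q) = smul c p + smul c q"
  by (simp add: smul_def fmul_eq_times distrib_left)

lemma smul_smul: "smul c (smul d p) = smul (c * d) p"
  by (simp add: smul_def fmul_eq_times mult_single plus_list_def flip: mult.assoc)

lemma smul_one: "smul 1 p = p"
  by (simp add: smul_def fmul_eq_times single_Nil_one)

lemma smul_zero: "smul c 0 = 0"
  by (simp add: smul_def fmul_eq_times)

lemma poly_mapping_induct_single [case_names single add]:
  fixes p :: "'a \<Rightarrow>\<^sub>0 'b::comm_monoid_add"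
  assumes "\<And>w c. P (Poly_Mapping.single w c)" "\<And>p q. P p \<Longrightarrow> P q \<Longrightarrow> P (p + q)"
  shows "P p"
proof -
  have "P (\<Sum>w\<in>B. Poly_Mapping.single w (Poly_Mapping.lookup p w))" if "finite B" for B
    \<comment> \<open>The empty sum is obtained as a monomial with coefficient 0.\<close>
    using that by (induction B rule: finite_induct) (use assms(1)[of undefined 0] assms in auto)
  from this[of "Poly_Mapping.keys p"] show ?thesis by (simp add: sum_single_lookup)
qed

lemma smul_mult_left: "smul c p * q = smul c (p * q)"
  by (simp add: smul_def fmul_eq_times mult.assoc)

text \<open>A scalar is a monomial at the empty word. Such monomials are central because
  \<open>[]\<close> is neutral on both sides and K is commutative; it is enough to see this on
  monomials.\<close>

lemma smul_mult_right: "p * smul c q = smul c (p * q)"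
proof (induction p rule: poly_mapping_induct_single)
  case (single w d)
  show ?case
    by (induction q rule: poly_mapping_induct_single)
      (simp_all add: smul_single mult_single smul_add distrib_left mult.left_commute)
qed (simp add: smul_add distrib_right)

section \<open>Linear extension from words\<close>

text \<open>Only scalar-valued extensions are formed; the action on functions below applies this at
  each point separately.\<close>

definition lext :: "('a \<Rightarrow> 'k) \<Rightarrow> ('a \<Rightarrow>\<^sub>0 'k::field) \<Rightarrow> 'k" where
  "lext f p = (\<Sum>w\<in>Poly_Mapping.keys p. Poly_Mapping.lookup p w * f w)"

lemma lext_superset:
  assumes "finite B" "Poly_Mapping.keys p \<subseteq> B"
  shows "lext f p = (\<Sum>w\<in>B. Poly_Mapping.lookup p w * f w)"
  unfolding lext_def using assms by (intro sum.mono_neutral_left) (auto simp: in_keys_iff)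

lemma lext_add: "lext f (p + q) = lext f p + lext f q"
proof -
  let ?B = "Poly_Mapping.keys p \<union> Poly_Mapping.keys q"
  have "Poly_Mapping.keys (p + q) \<subseteq> ?B" by (rule keys_add)
  then show ?thesis
    by (simp add: lext_superset[of ?B] lookup_add distrib_right sum.distrib)
qed

lemma lext_single: "lext f (Poly_Mapping.single w c) = c * f w"
  by (simp add: lext_def)

lemma fstar_superset:
  assumes "finite B" "Poly_Mapping.keys p \<subseteq> B"
  shows "fstar p = (\<Sum>w\<in>B. Poly_Mapping.single (rev (map gstar w)) (Poly_Mapping.lookup p w))"
  unfolding fstar_def using assms by (intro sum.mono_neutral_left) (auto simp: in_keys_iff)

lemma fstar_add: "fstar (p + q) = fstar p + fstar q"
proof -
  let ?B = "Poly_Mapping.keys p \<union> Poly_Mapping.keys q"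
  have "Poly_Mapping.keys (p + q) \<subseteq> ?B" by (rule keys_add)
  then show ?thesis
    by (simp add: fstar_superset[of ?B] lookup_add single_add sum.distrib)
qed

lemma fstar_single: "fstar (Poly_Mapping.single w c) = Poly_Mapping.single (rev (map gstar w)) c"
  by (simp add: fstar_def)

section \<open>Spans\<close>

lemma kspan_smul: "x \<in> kspan X \<Longrightarrow> smul c x \<in> kspan X"
  by (induction rule: kspan.induct) (auto simp: smul_zero smul_smul smul_add intro: kspan.intros)

lemma kspan_superset: "x \<in> X \<Longrightarrow> x \<in> kspan X"
  using kspan.base[of x X 1] by (simp add: smul_one)

lemma kspan_least:
  assumes "X \<subseteq> kspan Y" shows "kspan X \<subseteq> kspan Y"
proof
  fix x assume "x \<in> kspan X"
  then show "x \<in> kspan Y"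
    by induction (use assms in \<open>auto intro: kspan.intros kspan_smul\<close>)
qed

lemma kspan_minus: "x \<in> kspan X \<Longrightarrow> - x \<in> kspan X"
  using kspan_smul[of x X "-1"] by (simp add: smul_def fmul_eq_times single_uminus single_Nil_one)

lemma kspan_diff: "x \<in> kspan X \<Longrightarrow> y \<in> kspan X \<Longrightarrow> x - y \<in> kspan X"
  using kspan.add[OF _ kspan_minus] by force

text \<open>Both factors are expanded by induction over their spans, so Jordan products of subspaces
  can be computed on spanning sets.\<close>

lemma kspan_jordan_bilinear:
  assumes "x \<in> kspan X" "y \<in> kspan Y" "\<And>x y. x \<in> X \<Longrightarrow> y \<in> Y \<Longrightarrow> x * y + y * x \<in> kspan Z"
  shows "x * y + y * x \<in> kspan Z"
  using assms(1)
proof induction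
  case (base x c)
  from assms(2) have "x * y + y * x \<in> kspan Z"
  proof induction
    case (base y d)
    then show ?case using assms(3)[OF \<open>x \<in> X\<close> base]
      by (simp add: smul_mult_left smul_mult_right kspan_smul flip: smul_add)
  next
    case (add y1 y2)
    have "x * (y1 + y2) + (y1 + y2) * x = (x * y1 + y1 * x) + (x * y2 + y2 * x)"
      by (simp add: algebra_simps)
    with add show ?case by (simp add: kspan.add)
  qed (auto intro: kspan.intros)
  then show ?case by (simp add: smul_mult_left smul_mult_right kspan_smul flip: smul_add)
next
  case (add x1 x2)
  have "(x1 + x2) * y + y * (x1 + x2) = (x1 * y + y * x1) + (x2 * y + y * x2)"
    by (simp add: algebra_simps)
  with add show ?case by (simp add: kspan.add)
qed (auto intro: kspan.intros)

section \<open>The ideal of relations\<close>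

locale lpa =
  fixes V :: "'v set" and Ed :: "'e set" and s r :: "'e \<Rightarrow> 'v" and ty :: "'k::field itself"
  assumes graph: "graph V Ed s r"
begin

abbreviation I :: "('v, 'e, 'k) falg set" where "I \<equiv> lpa_ideal V Ed s r"

definition A :: "('v, 'e, 'k) falg set" where
  "A = {p. \<forall>w\<in>Poly_Mapping.keys p. set w \<subseteq> gens V Ed}"

lemma s_in: "e \<in> Ed \<Longrightarrow> s e \<in> V" and r_in: "e \<in> Ed \<Longrightarrow> r e \<in> V"
  using graph by (auto simp: graph_def)

lemma I_minus: "x \<in> I \<Longrightarrow> - x \<in> I"
  using lpa_ideal.smul[of x V Ed s r "-1"]
  by (simp add: smul_def fmul_eq_times single_uminus single_Nil_one)

lemma A_split:
  assumes "a \<in> A"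
  obtains c b where "b \<in> free_alg V Ed" "a = Poly_Mapping.single [] c + b"
proof -
  let ?c = "Poly_Mapping.lookup a []"
  let ?b = "a - Poly_Mapping.single [] ?c"
  have "Poly_Mapping.lookup ?b w \<noteq> 0 \<Longrightarrow> w \<noteq> [] \<and> w \<in> Poly_Mapping.keys a" for w
    by (cases "w = []") (auto simp: lookup_minus lookup_single when_def in_keys_iff)
  then have "?b \<in> free_alg V Ed"
    using assms by (auto simp: free_alg_def A_def in_keys_iff)
  then show ?thesis using that by force
qed

lemma A_I_mult_left:
  assumes "a \<in> A" "x \<in> I" shows "a * x \<in> I"
proof -
  obtain c b where cb: "b \<in> free_alg V Ed" "a = Poly_Mapping.single [] c + b"
    using A_split[OF assms(1)] .
  have "a * x = smul c x + fmul b x"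
    using cb(2) by (simp add: smul_def fmul_eq_times distrib_right)
  then show ?thesis
    using lpa_ideal.add[OF lpa_ideal.smul lpa_ideal.mult_left, OF assms(2) cb(1) assms(2)] by simp
qed

lemma A_I_mult_right:
  assumes "a \<in> A" "x \<in> I" shows "x * a \<in> I"
proof -
  obtain c b where cb: "b \<in> free_alg V Ed" "a = Poly_Mapping.single [] c + b"
    using A_split[OF assms(1)] .
  have "x * Poly_Mapping.single [] c = smul c x"
    using smul_mult_right[of x c 1] by (simp add: smul_def fmul_eq_times)
  then have "x * a = smul c x + fmul x b"
    using cb(2) by (simp add: fmul_eq_times distrib_left)
  then show ?thesis
    using lpa_ideal.add[OF lpa_ideal.smul lpa_ideal.mult_right, OF assms(2) cb(1) assms(2)] by simp
qed

lemma A_add: "a \<in> A \<Longrightarrow> b \<in> A \<Longrightarrow> a + b \<in> A"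
  unfolding A_def using keys_add[of a b] by blast

lemma A_zero: "0 \<in> A" by (simp add: A_def)

lemma A_mult: "a \<in> A \<Longrightarrow> b \<in> A \<Longrightarrow> a * b \<in> A"
  unfolding A_def using keys_mult[of a b] by (fastforce simp: plus_list_def)

lemma A_single: "set w \<subseteq> gens V Ed \<Longrightarrow> Poly_Mapping.single w c \<in> A"
  by (simp add: A_def)

lemma A_smul: "a \<in> A \<Longrightarrow> smul c a \<in> A"
  by (simp add: smul_def fmul_eq_times A_mult A_single)

lemma A_uminus: "a \<in> A \<Longrightarrow> - a \<in> A"
  by (simp add: A_def)

lemma A_diff: "a \<in> A \<Longrightarrow> b \<in> A \<Longrightarrow> a - b \<in> A"
  using A_add[OF _ A_uminus] by force

lemma free_alg_subset_A: "free_alg V Ed \<subseteq> A"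
  by (auto simp: free_alg_def A_def)

lemma A_sum: "(\<And>b. b \<in> B \<Longrightarrow> f b \<in> A) \<Longrightarrow> sum f B \<in> A"
  by (induction B rule: infinite_finite_induct) (auto intro: A_zero A_add)

abbreviation gv :: "'v \<Rightarrow> ('v, 'e, 'k) falg" where "gv v \<equiv> gen1 (GV v)"
abbreviation ge :: "'e \<Rightarrow> ('v, 'e, 'k) falg" where "ge e \<equiv> gen1 (GE e)"
abbreviation gs :: "'e \<Rightarrow> ('v, 'e, 'k) falg" where "gs e \<equiv> gen1 (GS e)"

lemma A_gv: "v \<in> V \<Longrightarrow> gv v \<in> A" and A_ge: "e \<in> Ed \<Longrightarrow> ge e \<in> A" and A_gs: "e \<in> Ed \<Longrightarrow> gs e \<in> A"
  by (auto simp: gen1_def gens_def intro!: A_single)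

lemmas A_intros = A_gv A_ge A_gs A_mult A_add A_zero s_in r_in

text \<open>Membership in \<open>A\<close> is built in, which makes \<open>\<approx>\<close> a congruence without side conditions.\<close>
definition eqv :: "('v, 'e, 'k) falg \<Rightarrow> ('v, 'e, 'k) falg \<Rightarrow> bool" (infix \<open>\<approx>\<close> 50) where
  "x \<approx> y \<longleftrightarrow> x \<in> A \<and> y \<in> A \<and> x - y \<in> I"

lemma eqv_refl: "x \<in> A \<Longrightarrow> x \<approx> x"
  by (simp add: eqv_def lpa_ideal.zero)

lemma eqv_sym: "x \<approx> y \<Longrightarrow> y \<approx> x"
  using I_minus[of "x - y"] by (auto simp: eqv_def)

lemma eqv_trans [trans]: "x \<approx> y \<Longrightarrow> y \<approx> z \<Longrightarrow> x \<approx> z"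
  using lpa_ideal.add[of "x - y" V Ed s r "y - z"] by (auto simp: eqv_def)

lemma eqv_add: "x \<approx> y \<Longrightarrow> x' \<approx> y' \<Longrightarrow> x + x' \<approx> y + y'"
  using lpa_ideal.add[of "x - y" V Ed s r "x' - y'"] by (auto simp: eqv_def A_add algebra_simps)

lemma eqv_mult:
  assumes "x \<approx> y" "x' \<approx> y'" shows "x * x' \<approx> y * y'"
proof -
  have "x * x' - y * y' = x * (x' - y') + (x - y) * y'" by (simp add: algebra_simps)
  moreover have "x * (x' - y') \<in> I" "(x - y) * y' \<in> I"
    using assms by (auto simp: eqv_def intro: A_I_mult_left A_I_mult_right)
  ultimately show ?thesis using assms
    by (simp add: eqv_def A_mult lpa_ideal.add)
qed

lemma eqv_mult_left: "a \<in> A \<Longrightarrow> x \<approx> y \<Longrightarrow> a * x \<approx> a * y"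
  and eqv_mult_right: "a \<in> A \<Longrightarrow> x \<approx> y \<Longrightarrow> x * a \<approx> y * a"
  by (simp_all add: eqv_mult eqv_refl)

lemma eqv_zero_mult: "a \<in> A \<Longrightarrow> x \<approx> 0 \<Longrightarrow> a * x \<approx> 0" "a \<in> A \<Longrightarrow> x \<approx> 0 \<Longrightarrow> x * a \<approx> 0"
  using eqv_mult_left[of a x 0] eqv_mult_right[of a x 0] by auto

lemma rel_eqv:
  assumes "x - y \<in> lpa_rels V Ed s r" "x \<in> A" "y \<in> A" shows "x \<approx> y"
  unfolding eqv_def using assms lpa_ideal.rel[OF assms(1)] by simp

lemma gv_gv:
  assumes "v \<in> V" "v' \<in> V" shows "gv v * gv v' \<approx> (if v = v' then gv v else 0)"
proof (rule rel_eqv)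
  show "gv v * gv v' - (if v = v' then gv v else 0) \<in> lpa_rels V Ed s r"
    unfolding fmul_eq_times[symmetric] lpa_rels_def using assms by blast
qed (use assms in \<open>simp_all add: A_intros\<close>)

lemma s_ge: assumes "e \<in> Ed" shows "gv (s e) * ge e \<approx> ge e"
proof (rule rel_eqv)
  show "gv (s e) * ge e - ge e \<in> lpa_rels V Ed s r"
    unfolding fmul_eq_times[symmetric] lpa_rels_def using assms by blast
qed (use assms in \<open>simp_all add: A_intros\<close>)

lemma ge_r: assumes "e \<in> Ed" shows "ge e * gv (r e) \<approx> ge e"
proof (rule rel_eqv)
  show "ge e * gv (r e) - ge e \<in> lpa_rels V Ed s r"
    unfolding fmul_eq_times[symmetric] lpa_rels_def using assms by blast
qed (use assms in \<open>simp_all add: A_intros\<close>)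

lemma r_gs: assumes "e \<in> Ed" shows "gv (r e) * gs e \<approx> gs e"
proof (rule rel_eqv)
  show "gv (r e) * gs e - gs e \<in> lpa_rels V Ed s r"
    unfolding fmul_eq_times[symmetric] lpa_rels_def using assms by blast
qed (use assms in \<open>simp_all add: A_intros\<close>)

lemma gs_s: assumes "e \<in> Ed" shows "gs e * gv (s e) \<approx> gs e"
proof (rule rel_eqv)
  show "gs e * gv (s e) - gs e \<in> lpa_rels V Ed s r"
    unfolding fmul_eq_times[symmetric] lpa_rels_def using assms by blast
qed (use assms in \<open>simp_all add: A_intros\<close>)

lemma gs_ge:
  assumes "e \<in> Ed" "f \<in> Ed" shows "gs e * ge f \<approx> (if e = f then gv (r e) else 0)"
proof (rule rel_eqv)
  show "gs e * ge f - (if e = f then gv (r e) else 0) \<in> lpa_rels V Ed s r"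
    unfolding fmul_eq_times[symmetric] lpa_rels_def using assms by blast
qed (use assms in \<open>simp_all add: A_intros\<close>)

text \<open>The summation relation at a vertex with a single outgoing edge, which is the situation
  on loops and 2-cycles of sparse graphs.\<close>

lemma ge_gs:
  assumes "e \<in> Ed" "\<And>f. f \<in> Ed \<Longrightarrow> s f = s e \<Longrightarrow> f = e"
  shows "ge e * gs e \<approx> gv (s e)"
proof -
  have out: "{f \<in> Ed. s f = s e} = {e}" using assms by auto
  have "gv (s e) - (\<Sum>f\<in>{f \<in> Ed. s f = s e}. fmul (ge f) (gs f)) \<in> lpa_rels V Ed s r"
    unfolding lpa_rels_def
    by (intro UnI2 CollectI exI[of _ "s e"] conjI refl) (simp_all add: out s_in assms(1))
  from lpa_ideal.rel[OF this] have "gv (s e) - ge e * gs e \<in> I"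
    unfolding out by (simp add: fmul_eq_times)
  then show ?thesis by (rule_tac eqv_sym) (simp add: eqv_def A_intros assms(1))
qed

lemma gv_ge: "v \<in> V \<Longrightarrow> e \<in> Ed \<Longrightarrow> gv v * ge e \<approx> (if v = s e then ge e else 0)"
proof -
  assume a: "v \<in> V" "e \<in> Ed"
  have "gv v * ge e \<approx> gv v * (gv (s e) * ge e)"
    by (intro eqv_mult_left eqv_sym[OF s_ge] A_intros a)
  also have "gv v * (gv (s e) * ge e) \<approx> (if v = s e then gv v else 0) * ge e"
    unfolding mult.assoc[symmetric] by (intro eqv_mult_right gv_gv A_intros a)
  finally show ?thesis using s_ge a by (cases "v = s e") auto
qed

lemma gs_gv: "v \<in> V \<Longrightarrow> e \<in> Ed \<Longrightarrow> gs e * gv v \<approx> (if v = s e then gs e else 0)"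
proof -
  assume a: "v \<in> V" "e \<in> Ed"
  have "gs e * gv v \<approx> (gs e * gv (s e)) * gv v"
    by (intro eqv_mult_right eqv_sym[OF gs_s] A_intros a)
  also have "(gs e * gv (s e)) * gv v \<approx> gs e * (if s e = v then gv (s e) else 0)"
    unfolding mult.assoc by (intro eqv_mult_left gv_gv A_intros a)
  finally show ?thesis using gs_s a by (cases "v = s e") auto
qed

end

section \<open>A module on which all vertices act nontrivially\<close>

text \<open>Points are pairs of a vertex and an element of an infinite set absorbing products with sets
  of edges; so the points at a non-sink \<open>v\<close> are in bijection, by \<open>k v\<close>, with pairs of an edge
  leaving \<open>v\<close> and a point at its range.\<close>

context
  fixes s r :: "'e \<Rightarrow> 'v" and k :: "'v \<Rightarrow> 'z \<Rightarrow> 'e \<times> 'z"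
begin

text \<open>The edge e moves values at r(e) to the points over s(e) whose code begins with e, and
  \<open>e^*\<close> moves them back. The module consists of all functions, so vertices with
  infinitely many edges cause no trouble.\<close>

fun gact :: "('v, 'e) gen \<Rightarrow> ('v \<times> 'z \<Rightarrow> 'k::field) \<Rightarrow> 'v \<times> 'z \<Rightarrow> 'k" where
  "gact (GV v) \<phi> (u, z) = (if u = v then \<phi> (u, z) else 0)"
| "gact (GE e) \<phi> (u, z) = (if u = s e \<and> fst (k u z) = e then \<phi> (r e, snd (k u z)) else 0)"
| "gact (GS e) \<phi> (u, z) = (if u = r e then \<phi> (s e, inv (k (s e)) (e, z)) else 0)"

definition act :: "('v, 'e, 'k::field) falg \<Rightarrow> ('v \<times> 'z \<Rightarrow> 'k) \<Rightarrow> 'v \<times> 'z \<Rightarrow> 'k" where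
  "act p \<phi> x = lext (\<lambda>w. List.foldr gact w \<phi> x) p"

lemma act_add: "act (p + q) \<phi> x = act p \<phi> x + act q \<phi> x"
  by (simp add: act_def lext_add)

lemma gact_add: "gact g (\<lambda>x. \<phi> x + \<psi> x) = (\<lambda>x. gact g \<phi> x + gact g \<psi> x)"
proof
  fix x show "gact g (\<lambda>x. \<phi> x + \<psi> x) x = gact g \<phi> x + gact g \<psi> x"
    by (cases x; cases g) auto
qed

lemma gact_scale: "gact g (\<lambda>x. c * \<phi> x) = (\<lambda>x. c * gact g \<phi> x)"
proof
  fix x show "gact g (\<lambda>x. c * \<phi> x) x = c * gact g \<phi> x"
    by (cases x; cases g) auto
qed

lemma foldr_gact_add: "List.foldr gact w (\<lambda>x. \<phi> x + \<psi> x) = (\<lambda>x. List.foldr gact w \<phi> x + List.foldr gact w \<psi> x)"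
  by (induction w) (simp_all add: gact_add)

lemma foldr_gact_scale: "List.foldr gact w (\<lambda>x. c * \<phi> x) = (\<lambda>x. c * List.foldr gact w \<phi> x)"
  by (induction w) (simp_all add: gact_scale)

lemma foldr_gact_zero: "List.foldr gact w (\<lambda>x. 0) = (\<lambda>x. 0)"
  using foldr_gact_scale[of w 0 "\<lambda>x. 0"] by simp

text \<open>\<open>foldr\<close> turns concatenation of words into composition of operators; the
  rest is linearity in each factor, in \<open>q\<close> by linearity of these operators.\<close>

lemma act_mult: "act (p * q) \<phi> x = act p (act q \<phi>) x"
proof (induction p rule: poly_mapping_induct_single)
  case (single u c)
  have act_single: "act (Poly_Mapping.single u c) \<psi> x = c * List.foldr gact u \<psi> x" for \<psi> x
    by (simp add: act_def lext_single)
  show ?case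
  proof (induction q arbitrary: x rule: poly_mapping_induct_single)
    case (single v d)
    have "act (Poly_Mapping.single v d) \<phi> = (\<lambda>x. d * List.foldr gact v \<phi> x)"
      by (simp add: act_def lext_single fun_eq_iff)
    then show ?case
      by (simp add: act_def mult_single lext_single plus_list_def foldr_gact_scale mult.assoc)
  next
    case (add q1 q2)
    have "act (q1 + q2) \<phi> = (\<lambda>x. act q1 \<phi> x + act q2 \<phi> x)"
      by (simp add: act_add fun_eq_iff)
    then have "act (Poly_Mapping.single u c) (act (q1 + q2) \<phi>) x
      = act (Poly_Mapping.single u c) (act q1 \<phi>) x + act (Poly_Mapping.single u c) (act q2 \<phi>) x"
      by (simp add: act_single foldr_gact_add distrib_left)
    with add show ?case by (simp only: distrib_left act_add[of "_ * _" "_ * _"])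
  qed
qed (simp add: distrib_right act_add)

lemma act_zero: "act p (\<lambda>x. 0) = (\<lambda>x. 0)"
  by (simp add: act_def lext_def foldr_gact_zero fun_eq_iff)

lemma act_gen1: "act (gen1 g) \<phi> x = gact g \<phi> x"
  by (simp add: act_def gen1_def lext_single)

lemma act_zero_left: "act 0 \<phi> x = 0"
  by (simp add: act_def lext_def)

lemma act_uminus: "act (- p) \<phi> x = - act p \<phi> x"
  using act_add[of p "- p" \<phi> x] by (simp add: act_zero_left eq_neg_iff_add_eq_0 add.commute)

lemma act_diff: "act (p - q) \<phi> x = act p \<phi> x - act q \<phi> x"
  using act_add[of p "- q" \<phi> x] by (simp add: act_uminus)

lemma act_sum: "act (sum f B) \<phi> x = (\<Sum>b\<in>B. act (f b) \<phi> x)"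
  by (induction B rule: infinite_finite_induct) (simp_all add: act_add act_zero_left)

lemma gact_GE_app: "gact (GE e) \<phi> x = (if fst x = s e \<and> fst (k (fst x) (snd x)) = e then \<phi> (r e, snd (k (fst x) (snd x))) else 0)"
  by (cases x) auto

lemma act_rels:
  assumes k: "\<And>e. e \<in> Ed \<Longrightarrow> bij_betw (k (s e)) UNIV ({f \<in> Ed. s f = s e} \<times> UNIV)"
  assumes x: "x \<in> lpa_rels V Ed s r"
  shows "act x \<phi> uz = 0"
proof -
  obtain u z where uz: "uz = (u, z)" by fastforce
  have kinv: "k (s e) (inv (k (s e)) (e, z)) = (e, z)" if "e \<in> Ed" for e z
  proof -
    have "(e, z) \<in> range (k (s e))" using k[OF that] that by (auto simp: bij_betw_def)
    then show ?thesis by (rule f_inv_into_f)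
  qed
  have invk: "inv (k (s e)) (k (s e) z) = z" if "e \<in> Ed" for e z
    using k[OF that] by (simp add: bij_betw_def)
  consider
      (vv) v v' where "x = fmul (gen1 (GV v)) (gen1 (GV v')) - (if v = v' then gen1 (GV v) else 0)"
    | (se) e where "x = fmul (gen1 (GV (s e))) (gen1 (GE e)) - gen1 (GE e)"
    | (er) e where "x = fmul (gen1 (GE e)) (gen1 (GV (r e))) - gen1 (GE e)"
    | (re) e where "x = fmul (gen1 (GV (r e))) (gen1 (GS e)) - gen1 (GS e)"
    | (es) e where "x = fmul (gen1 (GS e)) (gen1 (GV (s e))) - gen1 (GS e)"
    | (ck1) e f where "e \<in> Ed" "f \<in> Ed"
        "x = fmul (gen1 (GS e)) (gen1 (GE f)) - (if e = f then gen1 (GV (r e)) else 0)"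
    | (ck2) v where "finite {e\<in>Ed. s e = v}" "{e\<in>Ed. s e = v} \<noteq> {}"
        "x = gen1 (GV v) - (\<Sum>e\<in>{e\<in>Ed. s e = v}. fmul (gen1 (GE e)) (gen1 (GS e)))"
    using x unfolding lpa_rels_def by blast
  then show ?thesis
  proof cases
    case (ck1 e f)
    show ?thesis
    \<comment> \<open>For a common source, the point consulted by \<open>GS e\<close> has code
      beginning with e, by \<open>kinv\<close>, so \<open>GE f\<close> sees it only if f = e. For
      distinct sources \<open>GE f\<close> vanishes there.\<close>
    proof (cases "s e = s f")
      case True
      then show ?thesis using kinv[OF ck1(1), of z] ck1(3)
        by (auto simp: fmul_eq_times act_diff act_mult act_gen1 act_zero_left uz gact_GE_app)
    qed (use ck1 in \<open>auto simp: fmul_eq_times act_diff act_mult act_gen1 act_zero_left uz gact_GE_app\<close>)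
  next
    case (ck2 v)
    let ?out = "{e\<in>Ed. s e = v}"
    have act: "act x \<phi> uz = gact (GV v) \<phi> uz - (\<Sum>e\<in>?out. gact (GE e) (act (gen1 (GS e)) \<phi>) uz)"
      by (simp add: ck2(3) act_diff act_sum fmul_eq_times act_mult act_gen1)
    show ?thesis
    proof (cases "u = v")
      case True
      obtain e0 where e0: "e0 \<in> ?out" using ck2 by auto
      \<comment> \<open>At the point (v, z) only the edge encoded by \<open>k v z\<close>
        contributes to the sum, and its term restores the value of the function.\<close>
      obtain e z' where ez: "k v z = (e, z')" by fastforce
      have "(e, z') \<in> range (k v)" using ez[symmetric] by auto
      then have e: "e \<in> ?out" using k[of e0] e0 by (auto simp: bij_betw_def)
      have "(\<Sum>e'\<in>?out. gact (GE e') (act (gen1 (GS e')) \<phi>) uz)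
          = (\<Sum>e'\<in>?out. if e' = e then \<phi> (v, z) else 0)"
      proof (rule sum.cong)
        fix e' assume e': "e' \<in> ?out"
        then show "gact (GE e') (act (gen1 (GS e')) \<phi>) uz = (if e' = e then \<phi> (v, z) else 0)"
          using invk[of e' z] by (auto simp: uz True ez act_gen1)
      qed simp
      then show ?thesis using act e ck2(1) by (simp add: uz True)
    next
      case False
      then show ?thesis unfolding act by (simp add: uz)
    qed
  qed (auto simp: fmul_eq_times act_diff act_mult act_gen1 act_zero_left uz gact_GE_app)
qed

lemma act_ideal:
  assumes k: "\<And>e. e \<in> Ed \<Longrightarrow> bij_betw (k (s e)) UNIV ({f \<in> Ed. s f = s e} \<times> UNIV)"
  assumes x: "x \<in> lpa_ideal V Ed s r"
  shows "act x \<phi> = (\<lambda>_. 0)"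
  using x
proof (induction arbitrary: \<phi>)
  case (rel x)
  then show ?case using act_rels[OF k] by blast
qed (auto intro!: ext simp: act_zero_left act_add act_mult act_zero smul_def fmul_eq_times)

end

text \<open>The set of lists is infinite and every set of edges embeds in it, so its product with a
  nonempty set of edges has the same cardinality. At sinks the chosen \<open>k\<close> is
  arbitrary.\<close>

lemma ex_path_bijections:
  includes cardinal_syntax
  obtains k :: "'v \<Rightarrow> 'e option list \<Rightarrow> 'e \<times> 'e option list"
  where "\<And>e. e \<in> Ed \<Longrightarrow> bij_betw (k (s e)) UNIV ({f \<in> Ed. s f = s e} \<times> UNIV)"
proof -
  have bij: "\<exists>g :: 'e option list \<Rightarrow> 'e \<times> 'e option list. bij_betw g UNIV (B \<times> UNIV)" if "B \<noteq> {}" for B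
  proof -
    have "inj_on (\<lambda>e::'e. [Some e]) B" by (simp add: inj_on_def)
    then have "|B| \<le>o |UNIV :: 'e option list set|"
      using card_of_ordLeq[of B "UNIV :: 'e option list set"] by blast
    then have "|B \<times> (UNIV :: 'e option list set)| =o |UNIV :: 'e option list set|"
      using card_of_Times_infinite[of "UNIV :: 'e option list set" B] that infinite_UNIV_listI by blast
    then show ?thesis using card_of_ordIso ordIso_symmetric by blast
  qed
  have "bij_betw (SOME g :: 'e option list \<Rightarrow> 'e \<times> 'e option list.
      bij_betw g UNIV ({f \<in> Ed. s f = s e} \<times> UNIV)) UNIV ({f \<in> Ed. s f = s e} \<times> UNIV)"
    if "e \<in> Ed" for e
    using that by (intro someI_ex[where P = "\<lambda>g. bij_betw g UNIV ({f \<in> Ed. s f = s e} \<times> UNIV)"] bij) auto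
  then show ?thesis
    by (rule that[of "\<lambda>v. SOME g. bij_betw g UNIV ({f \<in> Ed. s f = v} \<times> UNIV)"])
qed

text \<open>The ideal acts by zero, but v preserves the value of the constant function 1 at points
  over v. Every later proof that an element is nonzero reduces to this one.\<close>

lemma (in lpa) vertex_notin_ideal: "gv v \<notin> I"
proof
  assume v: "gv v \<in> I"
  obtain k :: "'v \<Rightarrow> 'e option list \<Rightarrow> 'e \<times> 'e option list" where
    k: "\<And>e. e \<in> Ed \<Longrightarrow> bij_betw (k (s e)) UNIV ({f \<in> Ed. s f = s e} \<times> UNIV)"
    using ex_path_bijections[of Ed s] by blast
  have "act s r k (gv v) (\<lambda>_. 1) (v, []) = 0"
    using act_ideal[of Ed k s, OF k v] by simp
  then show False by (simp add: act_gen1)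
qed

section \<open>Obstructions\<close>

context lpa
begin

abbreviation S :: "('v, 'e, 'k) falg set" where "S \<equiv> lpa_sym V Ed s r"

lemma jcirc_superset_ideal: "x \<in> I \<Longrightarrow> x \<in> jcirc I X Y"
  unfolding jcirc_def by (rule kspan_superset) simp

lemma jcirc_memI:
  assumes "a \<in> X" "b \<in> Y" "a * b + b * a \<approx> c" shows "c \<in> jcirc I X Y"
proof -
  have "a * b + b * a \<in> jcirc I X Y"
    unfolding jcirc_def fmul_eq_times[symmetric] using assms by (intro kspan_superset) blast
  moreover have "a * b + b * a - c \<in> jcirc I X Y"
    using assms(3) by (simp add: eqv_def jcirc_superset_ideal)
  ultimately have "(a * b + b * a) - (a * b + b * a - c) \<in> jcirc I X Y"
    unfolding jcirc_def by (rule kspan_diff)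
  then show ?thesis by simp
qed

text \<open>A set whose members are Jordan products of its own members persists in every term of
  both series, so one member outside the ideal is enough.\<close>

lemma not_solvable_perfect:
  assumes "X \<subseteq> S" "x \<in> X" "x \<notin> I" "\<And>x. x \<in> X \<Longrightarrow> \<exists>a\<in>X. \<exists>b\<in>X. a * b + b * a \<approx> x"
  shows "\<not> lpa_sym_jordan_solvable V Ed s r TYPE('k)" "\<not> lpa_sym_jordan_nilpotent V Ed s r TYPE('k)"
proof -
  have "X \<subseteq> jderived I S n" for n
  proof (induction n)
    case (Suc n)
    show ?case
    proof
      fix x assume "x \<in> X"
      then obtain a b where "a \<in> X" "b \<in> X" "a * b + b * a \<approx> x" using assms(4) by blast
      then show "x \<in> jderived I S (Suc n)"
        using Suc jcirc_memI[of a "jderived I S n" b "jderived I S n" x] by auto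
    qed
  qed (use assms in simp)
  then show "\<not> lpa_sym_jordan_solvable V Ed s r TYPE('k)"
    using assms(2,3) unfolding lpa_sym_jordan_solvable_def by blast
  have "X \<subseteq> jlower I S n" for n
  proof (induction n)
    case (Suc n)
    show ?case
    proof
      fix x assume "x \<in> X"
      then obtain a b where "a \<in> X" "b \<in> X" "a * b + b * a \<approx> x" using assms(4) by blast
      then show "x \<in> jlower I S (Suc n)"
        using Suc jcirc_memI[of a "jlower I S n" b S x] assms(1) by auto
    qed
  qed (use assms in simp)
  then show "\<not> lpa_sym_jordan_nilpotent V Ed s r TYPE('k)"
    using assms(2,3) unfolding lpa_sym_jordan_nilpotent_def by blast
qed

text \<open>An eigenvector with eigenvalue 1 of Jordan multiplication by a symmetric element
  survives in every term of the lower series.\<close>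

lemma not_nilpotent_eigen:
  assumes "x \<in> S" "x \<notin> I" "b \<in> S" "x * b + b * x \<approx> x"
  shows "\<not> lpa_sym_jordan_nilpotent V Ed s r TYPE('k)"
proof -
  have "x \<in> jlower I S n" for n
    by (induction n) (use assms in \<open>auto intro: jcirc_memI[of x _ b]\<close>)
  then show ?thesis using assms unfolding lpa_sym_jordan_nilpotent_def by blast
qed

section \<open>Words, their adjoints, and obstructions built from paths\<close>

definition wd :: "('v, 'e) gen list \<Rightarrow> ('v, 'e, 'k) falg" where
  "wd w = Poly_Mapping.single w 1"

definition ws :: "('v, 'e) gen list \<Rightarrow> ('v, 'e) gen list" where
  "ws w = rev (map gstar w)"

lemma wd_append: "wd (u @ v) = wd u * wd v"
  by (simp add: wd_def mult_single plus_list_def)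

lemma wd_single: "wd [g] = gen1 g"
  by (simp add: wd_def gen1_def)

lemma wd_Cons: "w \<noteq> [] \<Longrightarrow> wd (g # w) = gen1 g * wd w"
  using wd_append[of "[g]" w] by (simp add: wd_single)

lemma gstar_gstar: "gstar (gstar g) = g"
  by (cases g) auto

lemma ws_ws: "ws (ws w) = w"
  by (simp add: ws_def rev_map gstar_gstar comp_def)

lemma ws_append: "ws (u @ v) = ws v @ ws u"
  by (simp add: ws_def)

lemma ws_gens: "set w \<subseteq> gens V Ed \<Longrightarrow> set (ws w) \<subseteq> gens V Ed"
  by (auto simp: ws_def gens_def)

lemma A_wd: "set w \<subseteq> gens V Ed \<Longrightarrow> wd w \<in> A"
  by (simp add: wd_def A_single)

lemma wd_free: "set w \<subseteq> gens V Ed \<Longrightarrow> w \<noteq> [] \<Longrightarrow> wd w \<in> free_alg V Ed"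
  by (simp add: wd_def free_alg_def)

lemma free_alg_add: "a \<in> free_alg V Ed \<Longrightarrow> b \<in> free_alg V Ed \<Longrightarrow> a + b \<in> free_alg V Ed"
  unfolding free_alg_def using keys_add[of a b] by blast

lemma wd_sym: "set w \<subseteq> gens V Ed \<Longrightarrow> w \<noteq> [] \<Longrightarrow> wd w + wd (ws w) \<in> S"
  using ws_gens[of w] unfolding lpa_sym_def
  by (simp add: fstar_add lpa_ideal.zero wd_free free_alg_add ws_def)
    (simp add: wd_def fstar_single rev_map gstar_gstar comp_def lpa_ideal.zero)

lemma gv_sym: "v \<in> V \<Longrightarrow> gv v \<in> S"
  by (auto simp: lpa_sym_def gen1_def fstar_single free_alg_def gens_def lpa_ideal.zero)

text \<open>Three paths with common range, none a prefix of another, give off-diagonal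
  \<open>3 \<times> 3\<close> matrix units, and in characteristic 2 the elements \<open>e\<^sub>i\<^sub>j + e\<^sub>j\<^sub>i\<close> span a perfect Lie
  algebra.\<close>
lemma antichain_not_solvable:
  fixes p :: "nat \<Rightarrow> ('v, 'e) gen list"
  assumes v: "v \<in> V" and p: "\<And>i. i < 3 \<Longrightarrow> set (p i) \<subseteq> gens V Ed \<and> p i \<noteq> []"
    and orth: "\<And>i j. i < 3 \<Longrightarrow> j < 3 \<Longrightarrow> wd (ws (p i)) * wd (p j) \<approx> (if i = j then gv v else 0)"
    and pv: "\<And>i. i < 3 \<Longrightarrow> wd (p i) * gv v \<approx> wd (p i)"
  shows "\<not> lpa_sym_jordan_solvable V Ed s r TYPE('k)" "\<not> lpa_sym_jordan_nilpotent V Ed s r TYPE('k)"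
proof -
  define u where "u i j = wd (p i) * wd (ws (p j))" for i j
  define X where "X = {u i j + u j i | i j. i < 3 \<and> j < 3 \<and> i \<noteq> j}"
  have pA: "wd (p i) \<in> A" "wd (ws (p i)) \<in> A" if "i < 3" for i
    using p[OF that] A_wd[of "p i"] A_wd[OF ws_gens, of "p i"] by auto
  have uA: "u i j \<in> A" if "i < 3" "j < 3" for i j
    using that by (simp add: u_def pA A_mult)
  have uu: "u i j * u k l \<approx> (if j = k then u i l else 0)" if "i < 3" "j < 3" "k < 3" "l < 3" for i j k l
  proof -
    have "u i j * u k l = wd (p i) * (wd (ws (p j)) * wd (p k)) * wd (ws (p l))"
      by (simp add: u_def mult.assoc)
    also have "\<dots> \<approx> wd (p i) * (if j = k then gv v else 0) * wd (ws (p l))"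
      using that by (intro eqv_mult_right eqv_mult_left orth pA)
    also have "\<dots> \<approx> (if j = k then u i l else 0)"
      using that by (auto simp: u_def intro: eqv_mult_right pv pA eqv_refl A_zero)
    finally show ?thesis .
  qed
  have XS: "X \<subseteq> S"
  proof
    fix x assume "x \<in> X"
    then obtain i j where ij: "i < 3" "j < 3" "x = u i j + u j i" by (auto simp: X_def)
    have "x = wd (p i @ ws (p j)) + wd (ws (p i @ ws (p j)))"
      by (simp add: ij(3) u_def wd_append ws_append ws_ws)
    then show "x \<in> S" using wd_sym[of "p i @ ws (p j)"] p ij ws_gens by auto
  qed
  have XX: "\<exists>a\<in>X. \<exists>b\<in>X. a * b + b * a \<approx> x" if x: "x \<in> X" for x
  proof -
    obtain i j where ij: "i < 3" "j < 3" "i \<noteq> j" "x = u i j + u j i" using x by (auto simp: X_def)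
    \<comment> \<open>With k the third index, multiplying \<open>e_ik + e_ki\<close> and
      \<open>e_kj + e_jk\<close> in both orders leaves one product each, \<open>e_ij\<close> and
      \<open>e_ji\<close>; all other products have distinct inner indices. This works in every
      characteristic.\<close>
    obtain k where k: "k < 3" "k \<noteq> i" "k \<noteq> j"
    proof -
      have "card {0, 1, 2 :: nat} = 3" "card {i, j} \<le> 2"
        using card_insert_le_m1[of 2 "{j}" i] by auto
      then have "\<not> {0, 1, 2} \<subseteq> {i, j}"
        using card_mono[of "{i, j}" "{0, 1, 2}"] by auto
      then show ?thesis using that[of 0] that[of 1] that[of 2] by auto
    qed
    let ?a = "u i k + u k i" and ?b = "u k j + u j k"
    have a: "?a \<in> X" "?b \<in> X" using ij k by (auto simp: X_def)
    have "?a * ?b + ?b * ?a = (u i k * u k j + u i k * u j k + u k i * u k j + u k i * u j k)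
       + (u k j * u i k + u k j * u k i + u j k * u i k + u j k * u k i)"
      by (simp add: algebra_simps)
    also have "\<dots> \<approx> (u i j + 0 + 0 + 0) + (0 + 0 + 0 + u j i)"
      using ij k uu[of i k k j] uu[of i k j k] uu[of k i k j] uu[of k i j k]
        uu[of k j i k] uu[of k j k i] uu[of j k i k] uu[of j k k i]
      by (intro eqv_add) simp_all
    finally have "?a * ?b + ?b * ?a \<approx> x" using ij by simp
    with a show ?thesis by blast
  qed
  have x: "u 0 1 + u 1 0 \<in> X"
    unfolding X_def by force
  have "u 0 1 + u 1 0 \<notin> I"
  proof
    assume "u 0 1 + u 1 0 \<in> I"
    then have "u 0 1 + u 1 0 \<approx> 0" using uA by (simp add: eqv_def A_add A_zero)
    \<comment> \<open>Compression by \<open>p 0\<close> and \<open>p 1\<close> isolates the (0, 1)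
      entry, which is the vertex v.\<close>
    then have "wd (ws (p 0)) * (u 0 1 + u 1 0) * wd (p 1) \<approx> 0"
      using pA by (intro eqv_zero_mult) auto
    moreover have "wd (ws (p 0)) * (u 0 1 + u 1 0) * wd (p 1)
       = (wd (ws (p 0)) * wd (p 0)) * (wd (ws (p 1)) * wd (p 1))
       + (wd (ws (p 0)) * wd (p 1)) * (wd (ws (p 0)) * wd (p 1))"
      by (simp add: u_def algebra_simps)
    moreover have "\<dots> \<approx> gv v * gv v + 0 * 0"
      using orth[of 0 0] orth[of 1 1] orth[of 0 1] by (intro eqv_add eqv_mult) auto
    moreover have "gv v * gv v + 0 * 0 \<approx> gv v" using gv_gv[OF v v] by simp
    ultimately have "gv v \<approx> 0" by (metis eqv_sym eqv_trans)
    then show False using vertex_notin_ideal by (simp add: eqv_def)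
  qed
  from not_solvable_perfect[OF XS x this XX]
  show "\<not> lpa_sym_jordan_solvable V Ed s r TYPE('k)" "\<not> lpa_sym_jordan_nilpotent V Ed s r TYPE('k)"
    by blast+
qed

lemma nonloop_not_nilpotent:
  assumes e: "e \<in> Ed" "s e \<noteq> r e"
  shows "\<not> lpa_sym_jordan_nilpotent V Ed s r TYPE('k)"
proof (rule not_nilpotent_eigen)
  let ?x = "ge e + gs e"
  show "?x \<in> S" using wd_sym[of "[GE e]"] e by (simp add: wd_single ws_def gens_def)
  show "gv (r e) \<in> S" using gv_sym e r_in by simp
  have "?x * gv (r e) + gv (r e) * ?x
      = (ge e * gv (r e) + gs e * gv (r e)) + (gv (r e) * ge e + gv (r e) * gs e)"
    by (simp add: algebra_simps)
  also have "\<dots> \<approx> (ge e + 0) + (0 + gs e)"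
    using gs_gv[OF r_in e(1), OF e(1)] gv_ge[OF r_in e(1), OF e(1)] ge_r r_gs e
    by (intro eqv_add) auto
  finally show "?x * gv (r e) + gv (r e) * ?x \<approx> ?x" by simp
  show "?x \<notin> I"
  proof
    assume "?x \<in> I"
    then have "?x \<approx> 0" using e by (simp add: eqv_def A_intros)
    \<comment> \<open>The right factor r(e) kills \<open>e^*\<close> because e is not a loop, and
      the left factor turns the remaining e into r(e).\<close>
    then have "gs e * ?x * gv (r e) \<approx> 0" using e by (intro eqv_zero_mult) (auto intro: A_intros)
    moreover have "gs e * ?x * gv (r e) = gs e * (ge e * gv (r e)) + gs e * (gs e * gv (r e))"
      by (simp add: algebra_simps)
    moreover have "\<dots> \<approx> gs e * ge e + gs e * 0"
      using gs_gv[OF r_in e(1), OF e(1)] ge_r e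
      by (intro eqv_add eqv_mult_left A_intros) auto
    moreover have "gs e * ge e + gs e * 0 \<approx> gv (r e)" using gs_ge[OF e(1) e(1)] by simp
    ultimately have "gv (r e) \<approx> 0" by (metis eqv_sym eqv_trans)
    then show False using vertex_notin_ideal by (simp add: eqv_def)
  qed
qed

lemma char_not_2_not_nilpotent:
  assumes "CHAR('k) \<noteq> 2" "v \<in> V"
  shows "\<not> lpa_sym_jordan_nilpotent V Ed s r TYPE('k)"
proof -
  have two: "(2::'k) \<noteq> 0"
  proof
    assume "(2::'k) = 0"
    then have "of_nat 2 = (0::'k)" by simp
    then have "CHAR('k) dvd 2" by (simp only: of_nat_eq_0_iff_char_dvd)
    moreover from this have "CHAR('k) \<le> 2" by (rule dvd_imp_le) simp
    ultimately have "CHAR('k) = 1 \<or> CHAR('k) = 2"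
      by (cases "CHAR('k)") (auto simp: le_Suc_eq numeral_2_eq_2)
    with assms show False by simp
  qed
  have "gv v \<in> jlower I S n" for n
  proof (induction n)
    case (Suc n)
    have "gv v * gv v + gv v * gv v \<approx> gv v + gv v"
      using gv_gv[OF assms(2) assms(2)] by (intro eqv_add) auto
    then have "gv v + gv v \<in> jlower I S (Suc n)"
      using jcirc_memI[OF Suc gv_sym[OF assms(2)]] by simp
    then have "smul (1 / 2) (gv v + gv v) \<in> jlower I S (Suc n)"
      by (simp add: jcirc_def kspan_smul)
    moreover have "smul (1 / 2) (gv v + gv v) = gv v"
      using two by (simp add: gen1_def smul_single flip: single_add)
    ultimately show ?case by simp
  qed (simp add: gv_sym assms)
  then show ?thesis using vertex_notin_ideal unfolding lpa_sym_jordan_nilpotent_def by blast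
qed

end

section \<open>Graphs without three incomparable paths to a common vertex\<close>

text \<open>An edgewise form of the absence of three incomparable paths with common range. The
  clauses exclude a path through three distinct vertices, two nonloop edges with one range (in
  particular parallel ones), and a loop whose base emits a second edge.\<close>

definition sparse :: "'e set \<Rightarrow> ('e \<Rightarrow> 'v) \<Rightarrow> ('e \<Rightarrow> 'v) \<Rightarrow> bool" where
  "sparse Ed s r \<longleftrightarrow>
     (\<forall>e\<in>Ed. \<forall>f\<in>Ed. r e = s f \<longrightarrow> s e = s f \<or> s f = r f \<or> s e = r f) \<and>
     (\<forall>e\<in>Ed. \<forall>f\<in>Ed. r e = r f \<longrightarrow> e = f \<or> s e = r e \<or> s f = r f) \<and>
     (\<forall>e\<in>Ed. \<forall>f\<in>Ed. s e = r e \<longrightarrow> s f = s e \<longrightarrow> f = e)"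

lemma sparse_path: "sparse Ed s r \<Longrightarrow> e \<in> Ed \<Longrightarrow> f \<in> Ed \<Longrightarrow> r e = s f \<Longrightarrow> s e = s f \<or> s f = r f \<or> s e = r f"
  and sparse_range: "sparse Ed s r \<Longrightarrow> e \<in> Ed \<Longrightarrow> f \<in> Ed \<Longrightarrow> r e = r f \<Longrightarrow> s e \<noteq> r e \<Longrightarrow> s f \<noteq> r f \<Longrightarrow> e = f"
  and sparse_loop: "sparse Ed s r \<Longrightarrow> e \<in> Ed \<Longrightarrow> f \<in> Ed \<Longrightarrow> s e = r e \<Longrightarrow> s f = s e \<Longrightarrow> f = e"
  unfolding sparse_def by blast+

section \<open>Components\<close>

lemma component_self: "v \<in> V \<Longrightarrow> v \<in> component V Ed s r v"
  by (simp add: component_def)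

lemma component_step:
  assumes "graph V Ed s r" "e \<in> Ed"
  shows "s e \<in> component V Ed s r v \<longleftrightarrow> r e \<in> component V Ed s r v"
proof -
  have "(s e, r e) \<in> adj Ed s r" "(r e, s e) \<in> adj Ed s r" using assms by (auto simp: adj_def)
  then show ?thesis using assms
    by (auto simp: component_def graph_def intro: rtrancl_into_rtrancl)
qed

lemma component_eqI:
  assumes "v \<in> C" "C \<subseteq> V" "\<And>x. x \<in> C \<Longrightarrow> (v, x) \<in> (adj Ed s r)\<^sup>*"
    and closed: "\<And>e. e \<in> Ed \<Longrightarrow> s e \<in> C \<longleftrightarrow> r e \<in> C"
  shows "component V Ed s r v = C"
proof -
  have "w \<in> C" if "(v, w) \<in> (adj Ed s r)\<^sup>*" for w
    using that by induction (use assms(1) closed in \<open>auto simp: adj_def\<close>)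
  with assms(2,3) show ?thesis by (auto simp: component_def)
qed

lemma component_cong:
  assumes "(v, w) \<in> adj Ed s r"
  shows "component V Ed s r v = component V Ed s r w"
proof -
  have "(w, v) \<in> adj Ed s r" using assms by (auto simp: adj_def)
  with assms show ?thesis
    by (auto simp: component_def intro: converse_rtrancl_into_rtrancl)
qed

lemma sparse_hub:
  assumes hub: "is_hub C EC s r w U W" shows "sparse EC s r"
proof -
  have edge: "s e = w \<and> r e \<in> U \<union> W \<or> s e = r e \<and> s e \<in> W" if "e \<in> EC" for e
    using hub that unfolding is_hub_def by blast
  have w: "w \<notin> U" "w \<notin> W" using hub unfolding is_hub_def by blast+
  have spoke: "e = f" if "e \<in> EC" "f \<in> EC" "s e = w" "s f = w" "r e = r f" for e f
    using hub that edge[of e] w unfolding is_hub_def by (metis Un_iff)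
  have loop: "e = f" if "e \<in> EC" "f \<in> EC" "s e \<in> W" "s f = s e" for e f
    using hub that edge[of e] edge[of f] w unfolding is_hub_def by metis
  show ?thesis
    unfolding sparse_def
  proof (intro conjI ballI impI)
    fix e f assume ef: "e \<in> EC" "f \<in> EC"
    show "s e = s f \<or> s f = r f \<or> s e = r f" if "r e = s f"
      using edge[OF ef(1)] edge[OF ef(2)] that w by auto
    show "e = f \<or> s e = r e \<or> s f = r f" if "r e = r f"
      using edge[OF ef(1)] edge[OF ef(2)] that spoke[OF ef] by auto
    show "f = e" if "s e = r e" "s f = s e"
      using edge[OF ef(1)] that loop[OF ef] w by auto
  qed
qed

text \<open>Each clause of \<open>sparse\<close> concerns two edges that meet, and such edges lie in
  one component.\<close>

lemma sparse_componentwise: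
  assumes g: "graph V Ed s r"
    and comp: "\<And>v. v \<in> V \<Longrightarrow> sparse (comp_edges Ed s (component V Ed s r v)) s r"
  shows "sparse Ed s r"
proof -
  have *: "\<exists>EC. sparse EC s r \<and> e \<in> EC \<and> f \<in> EC"
    if "e \<in> Ed" "f \<in> Ed" "s f = s e \<or> s f = r e \<or> r f = r e" for e f
  proof -
    let ?C = "component V Ed s r (s e)"
    have V: "s e \<in> V" using g that by (simp add: graph_def)
    then have "s e \<in> ?C" "s f \<in> ?C"
      using component_self[of "s e" V] component_step[OF g, of _ "s e"] that by metis+
    with that comp[OF V] show ?thesis by (auto simp: comp_edges_def)
  qed
  show ?thesis
    unfolding sparse_def
  proof (intro conjI ballI impI)
    fix e f assume ef: "e \<in> Ed" "f \<in> Ed"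
    show "s e = s f \<or> s f = r f \<or> s e = r f" if "r e = s f"
      using *[OF ef] sparse_path[of _ s r e f] that by auto
    show "e = f \<or> s e = r e \<or> s f = r f" if "r e = r f"
      using *[OF ef] sparse_range[of _ s r e f] that by auto
    show "f = e" if "s e = r e" "s f = s e"
      using *[OF ef] sparse_loop[of _ s r e f] that by auto
  qed
qed

lemma union_sparse:
  assumes "graph V Ed s r" "union_E1_to_E6 V Ed s r"
  shows "sparse Ed s r"
proof (rule sparse_componentwise[OF assms(1)])
  fix v assume "v \<in> V"
  let ?C = "component V Ed s r v"
  let ?EC = "comp_edges Ed s ?C"
  consider "is_E1 ?C ?EC s r" | "is_E2 ?C ?EC s r" | "is_E3 ?C ?EC s r"
    | w U W where "is_hub ?C ?EC s r w U W"
    using assms(2) \<open>v \<in> V\<close>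
    unfolding union_E1_to_E6_def components_all_def is_E4_def is_E5_def is_E6_def by blast
  then show "sparse ?EC s r"
  proof cases
    case 1
    then show ?thesis by (simp add: is_E1_def sparse_def)
  next
    case 2
    then obtain e where "?EC = {e}" unfolding is_E2_def by blast
    then show ?thesis by (simp add: sparse_def)
  next
    case 3
    then obtain a b e f where "a \<noteq> b" and EC: "?EC = {e, f}"
      and ends: "s e = a" "r e = b" "s f = b" "r f = a"
      unfolding is_E3_def by blast
    then show ?thesis unfolding sparse_def EC by (simp add: ends)
  qed (rule sparse_hub)
qed

section \<open>Determining the components of a sparse graph\<close>

lemma isolated_component:
  assumes g: "graph V Ed s r" and sp: "sparse Ed s r" and v: "v \<in> V"
    and isolated: "\<And>e. e \<in> Ed \<Longrightarrow> s e = v \<longleftrightarrow> r e = v"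
  shows "is_E1 (component V Ed s r v) (comp_edges Ed s (component V Ed s r v)) s r
       \<or> is_E2 (component V Ed s r v) (comp_edges Ed s (component V Ed s r v)) s r"
proof -
  have C: "component V Ed s r v = {v}"
    by (rule component_eqI) (use v isolated in auto)
  show ?thesis
  proof (cases "\<exists>e\<in>Ed. s e = v")
    case True
    then obtain e where e: "e \<in> Ed" "s e = v" by blast
    then have "r e = v" using isolated[OF e(1)] by simp
    have "comp_edges Ed s {v} = {e}"
    proof
      show "comp_edges Ed s {v} \<subseteq> {e}"
      proof
        fix f assume "f \<in> comp_edges Ed s {v}"
        then show "f \<in> {e}"
          using sparse_loop[OF sp e(1), of f] e(2) \<open>r e = v\<close> by (simp add: comp_edges_def)
      qed
    qed (simp add: comp_edges_def e)
    with e \<open>r e = v\<close> show ?thesis unfolding C is_E2_def by auto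
  next
    case False
    then show ?thesis unfolding C is_E1_def by (auto simp: comp_edges_def)
  qed
qed

text \<open>A loop d at s(e) tolerates no other edge there, so it would equal e. A nonloop d
  prolongs f, so it must return to s(f) = r(e), where only one nonloop edge may arrive.\<close>

lemma two_cycle_out:
  assumes sp: "sparse Ed s r" and e: "e \<in> Ed" "s e \<noteq> r e" and f: "f \<in> Ed" "s f = r e" "r f = s e"
    and d: "d \<in> Ed" "s d = s e"
  shows "d = e"
proof (cases "s d = r d")
  case True
  then show ?thesis using sparse_loop[OF sp d(1) e(1)] d(2) by simp
next
  case False
  then have "r d = r e" using sparse_path[OF sp f(1) d(1)] e f d by auto
  then show ?thesis using sparse_range[OF sp d(1) e(1)] False e by simp
qed

lemma two_cycle_in:
  assumes sp: "sparse Ed s r" and e: "e \<in> Ed" "s e \<noteq> r e" and f: "f \<in> Ed" "s f = r e" "r f = s e"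
    and d: "d \<in> Ed" "r d = s e"
  shows "d = f"
proof (cases "s d = r d")
  case True
  then show ?thesis using two_cycle_out[OF sp e f d(1)] d e by simp
next
  case False
  then show ?thesis using sparse_range[OF sp d(1) f(1)] d e f by simp
qed

lemma two_cycle_component:
  assumes g: "graph V Ed s r" and sp: "sparse Ed s r"
    and e: "e \<in> Ed" "s e \<noteq> r e" and f: "f \<in> Ed" "s f = r e" "r f = s e"
  shows "is_E3 (component V Ed s r (s e)) (comp_edges Ed s (component V Ed s r (s e))) s r"
proof -
  have edges: "d = e \<or> d = f" if d: "d \<in> Ed" "s d \<in> {s e, r e} \<or> r d \<in> {s e, r e}" for d
  proof -
    have e': "r e = s f" "s e = r f" and f': "s f \<noteq> r f" using e f by simp_all
    consider "s d = s e" | "s d = s f" | "r d = s e" | "r d = s f" using d(2) e' by auto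
    then show ?thesis
    proof cases
      case 1
      show ?thesis by (rule disjI1[OF two_cycle_out[OF sp e f d(1) 1]])
    next
      case 2
      show ?thesis by (rule disjI2[OF two_cycle_out[OF sp f(1) f' e(1) e'(2,1) d(1) 2]])
    next
      case 3
      show ?thesis by (rule disjI2[OF two_cycle_in[OF sp e f d(1) 3]])
    next
      case 4
      show ?thesis by (rule disjI1[OF two_cycle_in[OF sp f(1) f' e(1) e'(2,1) d(1) 4]])
    qed
  qed
  have C: "component V Ed s r (s e) = {s e, r e}"
  proof (rule component_eqI)
    show "(s e, x) \<in> (adj Ed s r)\<^sup>*" if "x \<in> {s e, r e}" for x
      using that e by (auto simp: adj_def)
    show "s d \<in> {s e, r e} \<longleftrightarrow> r d \<in> {s e, r e}" if "d \<in> Ed" for d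
      using edges[OF that] e f by auto
  qed (use g e in \<open>auto simp: graph_def\<close>)
  have "comp_edges Ed s {s e, r e} = {e, f}"
    using edges e f by (auto simp: comp_edges_def)
  then show ?thesis unfolding C is_E3_def using e f by blast
qed

text \<open>The source w of an edge without return edge is a hub. Sparseness forbids loops at w and
  edges into w; a neighbour of w then emits only a loop, because any other continuation of a spoke
  would have to return to w.\<close>

lemma hub_component:
  assumes g: "graph V Ed s r" and sp: "sparse Ed s r"
    and e: "e \<in> Ed" "s e \<noteq> r e" and no_back: "\<And>f. f \<in> Ed \<Longrightarrow> s f = r e \<Longrightarrow> r f \<noteq> s e"
  shows "is_E4 (component V Ed s r (s e)) (comp_edges Ed s (component V Ed s r (s e))) s r
       \<or> is_E5 (component V Ed s r (s e)) (comp_edges Ed s (component V Ed s r (s e))) s r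
       \<or> is_E6 (component V Ed s r (s e)) (comp_edges Ed s (component V Ed s r (s e))) s r"
proof -
  define w where "w = s e"
  define Y where "Y = r ` {d \<in> Ed. s d = w}"
  define W where "W = {y \<in> Y. \<exists>d\<in>Ed. s d = y}"
  define U where "U = Y - W"
  have UW: "U \<union> W = Y" "U \<inter> W = {}" by (auto simp: U_def W_def)
  have e': "s e = w" by (simp add: w_def)
  have nonloop: "r d \<noteq> w" if d: "d \<in> Ed" "s d = w" for d
  proof
    assume "r d = w"
    then have "e = d" by (intro sparse_loop[OF sp d(1) e(1)]) (simp_all only: d e')
    then show False using \<open>r d = w\<close> e(2) d(2) by metis
  qed
  then have wY: "w \<notin> Y" by (auto simp: Y_def)
  \<comment> \<open>Followed by e, the edge d gives a path of length two. Since d and e are not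
    loops, d would have to start at r(e), against \<open>no_back\<close>.\<close>
  have into_w: False if d: "d \<in> Ed" "r d = w" for d
    using sparse_path[OF sp d(1) e(1)] d e e' nonloop[OF d(1)] no_back[OF d(1)] by metis
  have from_Y: "r d = s d" if d: "d \<in> Ed" "s d \<in> Y" for d
  proof -
    obtain c where c: "c \<in> Ed" "s c = w" "r c = s d" using d by (auto simp: Y_def)
    show ?thesis
      using sparse_path[OF sp c(1) d(1) c(3)] c nonloop[OF c(1,2)] into_w[OF d(1)] by metis
  qed
  have into_Y: "s d = w \<or> s d = r d" if d: "d \<in> Ed" "r d \<in> Y" for d
  proof -
    obtain c where c: "c \<in> Ed" "s c = w" "r c = r d" using d by (auto simp: Y_def)
    show ?thesis
      using sparse_range[OF sp c(1) d(1) c(3)] c nonloop[OF c(1,2)] by metis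
  qed
  have C: "component V Ed s r w = insert w Y"
  proof (rule component_eqI)
    show "(w, x) \<in> (adj Ed s r)\<^sup>*" if "x \<in> insert w Y" for x
      using that by (auto simp: Y_def adj_def)
    show "s d \<in> insert w Y \<longleftrightarrow> r d \<in> insert w Y" if "d \<in> Ed" for d
      using from_Y[OF that] into_Y[OF that] into_w[OF that] that by (auto simp: Y_def)
  qed (use g e in \<open>auto simp: graph_def w_def Y_def\<close>)
  let ?EC = "comp_edges Ed s (insert w Y)"
  have EC: "d \<in> ?EC \<longleftrightarrow> d \<in> Ed \<and> (s d = w \<or> s d \<in> Y)" for d by (auto simp: comp_edges_def)
  have "is_hub (insert w Y) ?EC s r w U W"
    unfolding is_hub_def UW
  proof (intro conjI ballI)
    show "w \<notin> U" "w \<notin> W" using wY UW by auto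
    show "s d = w \<and> r d \<in> Y \<or> s d = r d \<and> s d \<in> W" if "d \<in> ?EC" for d
    proof -
      have d: "d \<in> Ed" "s d = w \<or> s d \<in> Y" using that unfolding EC by blast+
      from d(2) show ?thesis
      proof
        assume "s d = w"
        then show ?thesis using d(1) unfolding Y_def by blast
      next
        assume "s d \<in> Y"
        then show ?thesis using from_Y[OF d(1)] d(1) unfolding W_def by auto
      qed
    qed
    show "\<exists>!d. d \<in> ?EC \<and> s d = w \<and> r d = x" if x: "x \<in> Y" for x
    proof -
      obtain c where c: "c \<in> Ed" "s c = w" "r c = x" using x by (auto simp: Y_def)
      show ?thesis
      proof (rule ex1I[of _ c])
        fix d assume d: "d \<in> ?EC \<and> s d = w \<and> r d = x"
        then have "d \<in> Ed" by (simp add: EC)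
        from nonloop[OF this] nonloop[OF c(1,2)] show "d = c"
          by (intro sparse_range[OF sp \<open>d \<in> Ed\<close> c(1)]) (use d c in metis)+
      qed (simp add: c EC)
    qed
    show "\<exists>!d. d \<in> ?EC \<and> s d = y \<and> r d = y" if y: "y \<in> W" for y
    proof -
      obtain c where c: "c \<in> Ed" "s c = y" "y \<in> Y" using y unfolding W_def by blast
      have "r c = y" using from_Y[OF c(1)] c by simp
      note c = this c
      show ?thesis
      proof (rule ex1I[of _ c])
        fix d assume d: "d \<in> ?EC \<and> s d = y \<and> r d = y"
        then have "d \<in> Ed" by (simp add: EC)
        then show "d = c" by (rule sparse_loop[OF sp c(2)]) (simp_all add: c d)
      qed (use y in \<open>simp add: c EC W_def\<close>)
    qed
  qed auto
  \<comment> \<open>As \<open>Y\<close> is nonempty, emptiness of \<open>U\<close> or of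
    \<open>W\<close> decides among the three hub types.\<close>
  moreover have "Y \<noteq> {}" using e by (auto simp: Y_def w_def)
  ultimately show ?thesis
    unfolding C[unfolded w_def] is_E4_def is_E5_def is_E6_def
    using UW w_def by (metis Un_empty)
qed

lemma sparse_union:
  assumes g: "graph V Ed s r" and sp: "sparse Ed s r"
  shows "union_E1_to_E6 V Ed s r"
  unfolding union_E1_to_E6_def components_all_def
proof
  fix v assume v: "v \<in> V"
  show "is_E1 (component V Ed s r v) (comp_edges Ed s (component V Ed s r v)) s r \<or>
        is_E2 (component V Ed s r v) (comp_edges Ed s (component V Ed s r v)) s r \<or>
        is_E3 (component V Ed s r v) (comp_edges Ed s (component V Ed s r v)) s r \<or>
        is_E4 (component V Ed s r v) (comp_edges Ed s (component V Ed s r v)) s r \<or>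
        is_E5 (component V Ed s r v) (comp_edges Ed s (component V Ed s r v)) s r \<or>
        is_E6 (component V Ed s r v) (comp_edges Ed s (component V Ed s r v)) s r"
  proof (cases "\<exists>e\<in>Ed. s e \<noteq> r e \<and> (s e = v \<or> r e = v)")
    case True
    then obtain e where e: "e \<in> Ed" "s e \<noteq> r e" "s e = v \<or> r e = v" by blast
    have "(s e, r e) \<in> adj Ed s r" using e by (auto simp: adj_def)
    then have "component V Ed s r v = component V Ed s r (s e)"
      using e(3) component_cong by metis
    then show ?thesis
      using two_cycle_component[OF g sp e(1,2)] hub_component[OF g sp e(1,2)] by metis
  next
    case False
    then have "s e = v \<longleftrightarrow> r e = v" if "e \<in> Ed" for e using that by metis
    from isolated_component[OF g sp v this] show ?thesis by blast
  qed
qed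

lemma union_E1_E2_iff:
  assumes g: "graph V Ed s r"
  shows "union_E1_E2 V Ed s r \<longleftrightarrow> sparse Ed s r \<and> (\<forall>e\<in>Ed. s e = r e)"
proof
  assume u: "union_E1_E2 V Ed s r"
  then have "union_E1_to_E6 V Ed s r"
    by (auto simp: union_E1_E2_def union_E1_to_E6_def components_all_def)
  then have "sparse Ed s r" using union_sparse g by blast
  moreover have "s e = r e" if e: "e \<in> Ed" for e
  proof -
    let ?C = "component V Ed s r (s e)"
    have "s e \<in> V" using g e by (simp add: graph_def)
    then have "s e \<in> ?C" "r e \<in> ?C" "\<exists>a. ?C = {a}"
      using component_self[of "s e" V] component_step[OF g e, of "s e"] u
      by (auto simp: union_E1_E2_def components_all_def is_E1_def is_E2_def)
    then show ?thesis by auto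
  qed
  ultimately show "sparse Ed s r \<and> (\<forall>e\<in>Ed. s e = r e)" by blast
next
  assume "sparse Ed s r \<and> (\<forall>e\<in>Ed. s e = r e)"
  then show "union_E1_E2 V Ed s r"
    unfolding union_E1_E2_def components_all_def
    by (intro ballI isolated_component[OF g]) simp_all
qed

section \<open>Three incomparable paths in graphs that are not sparse\<close>

context lpa
begin

text \<open>Removes one inner pair \<open>e^*\<close>, e from a product of an adjoint path with a
  path; iterating it compares paths letter by letter.\<close>

lemma gs_ge_cancel:
  assumes "e \<in> Ed" "x \<in> A" "y \<in> A" "gv (r e) * y \<approx> y"
  shows "x * gs e * (ge e * y) \<approx> x * y"
proof -
  have "x * gs e * (ge e * y) = x * (gs e * ge e * y)" by (simp add: mult.assoc)
  also have "\<dots> \<approx> x * (gv (r e) * y)"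
    using gs_ge[OF assms(1) assms(1)] assms(2,3) by (intro eqv_mult_left eqv_mult_right) auto
  also have "\<dots> \<approx> x * y" using assms by (intro eqv_mult_left)
  finally show ?thesis .
qed

lemma less_3_cases: "i < 3 \<Longrightarrow> i = 0 \<or> i = 1 \<or> i = (2::nat)"
  by auto

text \<open>The trivial path at r(f), the edge f and the path ef all end at r(f) and begin at three
  different vertices, so none is a prefix of another.\<close>

lemma path_obstruction:
  assumes ef: "e \<in> Ed" "f \<in> Ed" "r e = s f" "s e \<noteq> s f" "s f \<noteq> r f" "s e \<noteq> r f"
  shows "\<not> lpa_sym_jordan_solvable V Ed s r TYPE('k)"
proof (rule antichain_not_solvable(1)[where p = "\<lambda>i. [[GV (r f)], [GE f], [GE e, GE f]] ! i" and v = "r f"])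
  let ?p = "\<lambda>i. [[GV (r f)], [GE f], [GE e, GE f]] ! i"
  have A: "gv (r f) \<in> A" "ge e \<in> A" "ge f \<in> A" "gs e \<in> A" "gs f \<in> A"
    using ef by (auto intro: A_intros)
  note ws = ws_def wd_Cons wd_single
  fix i :: nat assume i: "i < 3"
  show "set (?p i) \<subseteq> gens V Ed \<and> ?p i \<noteq> []"
    using less_3_cases[OF i] ef r_in by (auto simp: gens_def)
  show "wd (?p i) * gv (r f) \<approx> wd (?p i)"
    using less_3_cases[OF i] gv_gv[of "r f" "r f"] ge_r[of f] eqv_mult_left[OF A(2) ge_r[of f]] ef r_in
    by (auto simp: ws mult.assoc)
  fix j :: nat assume j: "j < 3"
  have v: "r f \<in> V" using ef r_in by simp
  have 1: "gv (r f) * gv (r f) \<approx> gv (r f)" using gv_gv[OF v v] by simp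
  have 2: "gv (r f) * ge f \<approx> 0" using gv_ge[OF v ef(2)] ef by simp
  have 3: "gv (r f) * (ge e * ge f) \<approx> 0"
    using gv_ge[OF v ef(1)] ef eqv_zero_mult(2)[OF A(3), of "gv (r f) * ge e"] by (simp add: mult.assoc)
  have 4: "gs f * gv (r f) \<approx> 0" using gs_gv[OF v ef(2)] ef by simp
  have 5: "gs f * ge f \<approx> gv (r f)" using gs_ge[OF ef(2) ef(2)] by simp
  have ne: "e \<noteq> f" "f \<noteq> e" using ef by auto
  have 6: "gs f * (ge e * ge f) \<approx> 0"
    using ne gs_ge[OF ef(2) ef(1)] ef eqv_zero_mult(2)[OF A(3), of "gs f * ge e"] by (auto simp: mult.assoc)
  have 7: "gs f * gs e * gv (r f) \<approx> 0"
    using gs_gv[OF v ef(1)] ef eqv_zero_mult(1)[OF A(5), of "gs e * gv (r f)"] by (simp add: mult.assoc)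
  have 8: "gs f * gs e * ge f \<approx> 0"
    using ne gs_ge[OF ef(1,2)] ef eqv_zero_mult(1)[OF A(5), of "gs e * ge f"] by (auto simp: mult.assoc)
  have 9: "gs f * gs e * (ge e * ge f) \<approx> gv (r f)"
    using gs_ge_cancel[OF ef(1) A(5,3)] s_ge[OF ef(2)] 5 ef eqv_trans by simp
  show "wd (ws (?p i)) * wd (?p j) \<approx> (if i = j then gv (r f) else 0)"
    using less_3_cases[OF i] less_3_cases[OF j] 1 2 3 4 5 6 7 8 9
    by (elim disjE) (simp_all add: ws)
qed (use ef r_in in simp)

text \<open>The paths are e, f and the trivial one at their range; the latter is no prefix of e or f
  because neither is a loop.\<close>

lemma range_obstruction:
  assumes ef: "e \<in> Ed" "f \<in> Ed" "r e = r f" "e \<noteq> f" "s e \<noteq> r e" "s f \<noteq> r f"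
  shows "\<not> lpa_sym_jordan_solvable V Ed s r TYPE('k)"
proof (rule antichain_not_solvable(1)[where p = "\<lambda>i. [[GV (r f)], [GE e], [GE f]] ! i" and v = "r f"])
  let ?p = "\<lambda>i. [[GV (r f)], [GE e], [GE f]] ! i"
  note ws = ws_def wd_Cons wd_single
  have v: "r f \<in> V" using ef r_in by simp
  fix i :: nat assume i: "i < 3"
  show "set (?p i) \<subseteq> gens V Ed \<and> ?p i \<noteq> []"
    using less_3_cases[OF i] ef r_in by (auto simp: gens_def)
  show "wd (?p i) * gv (r f) \<approx> wd (?p i)"
    using less_3_cases[OF i] gv_gv[OF v v] ge_r[of e] ge_r[of f] ef by (auto simp: ws)
  fix j :: nat assume j: "j < 3"
  show "wd (ws (?p i)) * wd (?p j) \<approx> (if i = j then gv (r f) else 0)"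
    using less_3_cases[OF i] less_3_cases[OF j] ef gv_gv[OF v v] gv_ge[OF v ef(1)] gv_ge[OF v ef(2)]
      gs_gv[OF v ef(1)] gs_gv[OF v ef(2)] gs_ge[OF ef(1,1)] gs_ge[OF ef(1,2)] gs_ge[OF ef(2,1)] gs_ge[OF ef(2,2)]
    by (elim disjE) (simp_all add: ws)
qed (use ef r_in in simp)

text \<open>The paths f, ef and eef are incomparable because f differs from e; f may itself be a
  loop. The conclusion on nilpotency later excludes two loops at one vertex.\<close>

lemma loop_obstruction:
  assumes ef: "e \<in> Ed" "f \<in> Ed" "s e = r e" "s f = s e" "f \<noteq> e"
  shows "\<not> lpa_sym_jordan_solvable V Ed s r TYPE('k)" "\<not> lpa_sym_jordan_nilpotent V Ed s r TYPE('k)"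
proof -
  let ?p = "\<lambda>i. [[GE f], [GE e, GE f], [GE e, GE e, GE f]] ! i"
  have A: "ge e \<in> A" "ge f \<in> A" "gs e \<in> A" "gs f \<in> A"
    using ef by (auto intro: A_intros)
  note ws = ws_def wd_Cons wd_single
  have p: "set (?p i) \<subseteq> gens V Ed \<and> ?p i \<noteq> []" if "i < 3" for i
    using less_3_cases[OF that] ef by (auto simp: gens_def)
  have pv: "wd (?p i) * gv (r f) \<approx> wd (?p i)" if "i < 3" for i
    using less_3_cases[OF that] ge_r[of f] eqv_mult_left[OF A(1) ge_r[of f]]
      eqv_mult_left[OF A_mult[OF A(1) A(1)] ge_r[of f]] ef
    by (auto simp: ws mult.assoc)
  have sf: "gv (r e) * ge f \<approx> ge f" using s_ge[of f] ef by simp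
  have se: "gv (r e) * (ge e * ge f) \<approx> ge e * ge f"
    using eqv_mult_right[OF A(2) s_ge[of e]] ef by (simp add: mult.assoc)
  have 1: "gs f * ge f \<approx> gv (r f)" using gs_ge[OF ef(2) ef(2)] by simp
  have 2: "gs f * (ge e * y) \<approx> 0" if "y \<in> A" for y
    using gs_ge[OF ef(2) ef(1)] ef eqv_zero_mult(2)[OF that, of "gs f * ge e"] by (auto simp: mult.assoc)
  have 3: "x * gs e * ge f \<approx> 0" if "x \<in> A" for x
    using gs_ge[OF ef(1,2)] ef eqv_zero_mult(1)[OF that, of "gs e * ge f"] by (auto simp: mult.assoc)
  have 4: "x * gs e * (ge e * ge f) \<approx> x * ge f" if "x \<in> A" for x
    using gs_ge_cancel[OF ef(1) that A(2) sf] .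
  have 5: "x * gs e * (ge e * (ge e * ge f)) \<approx> x * (ge e * ge f)" if "x \<in> A" for x
    using gs_ge_cancel[OF ef(1) that A_mult[OF A(1,2)] se] .
  have orth: "wd (ws (?p i)) * wd (?p j) \<approx> (if i = j then gv (r f) else 0)" if "i < 3" "j < 3" for i j
  proof -
    have z1: "gs f * gs e * (ge e * ge f) \<approx> gv (r f)"
      using eqv_trans[OF 4[OF A(4)] 1] .
    have z2: "gs f * gs e * (ge e * (ge e * ge f)) \<approx> 0"
      using eqv_trans[OF 5[OF A(4)] 2[OF A(2)]] .
    have fe: "gs f * gs e \<in> A" using A by (simp add: A_mult)
    have z3: "gs f * gs e * gs e * (ge e * ge f) \<approx> 0"
      using eqv_trans[OF 4[OF fe] 3[OF A(4)]] .
    have z4: "gs f * gs e * gs e * (ge e * (ge e * ge f)) \<approx> gv (r f)"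
      using eqv_trans[OF 5[OF fe] z1] .
    show ?thesis
      using less_3_cases[OF that(1)] less_3_cases[OF that(2)] 1 2[OF A(2)] 2[OF A_mult[OF A(1,2)]]
        3[OF A(4)] 3[OF fe] z1 z2 z3 z4
      by (elim disjE) (simp_all add: ws mult.assoc)
  qed
  note * = antichain_not_solvable[of "r f" ?p, OF _ p orth pv]
  show "\<not> lpa_sym_jordan_solvable V Ed s r TYPE('k)" using *(1) ef r_in by blast
  show "\<not> lpa_sym_jordan_nilpotent V Ed s r TYPE('k)" using *(2) ef r_in by blast
qed

lemma solvable_sparse:
  assumes "lpa_sym_jordan_solvable V Ed s r TYPE('k)" shows "sparse Ed s r"
  unfolding sparse_def
proof (intro conjI ballI impI)
  fix e f assume ef: "e \<in> Ed" "f \<in> Ed"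
  show "s e = s f \<or> s f = r f \<or> s e = r f" if "r e = s f"
    using path_obstruction[OF ef that] assms by blast
  show "e = f \<or> s e = r e \<or> s f = r f" if "r e = r f"
    using range_obstruction[OF ef that] assms by blast
  show "f = e" if "s e = r e" "s f = s e"
    using loop_obstruction(1)[OF ef that] assms by blast
qed

end

section \<open>Matrix structure for sparse graphs\<close>

context lpa
begin

lemma lpa_rels_A: "x \<in> lpa_rels V Ed s r \<Longrightarrow> (x :: ('v, 'e, 'k) falg) \<in> A"
  unfolding lpa_rels_def fmul_eq_times
  by (elim UnE CollectE exE conjE) (auto intro!: A_diff A_sum A_intros)

lemma I_A: "x \<in> I \<Longrightarrow> x \<in> A"
  by (induction rule: lpa_ideal.induct)
    (use free_alg_subset_A in \<open>auto simp: fmul_eq_times intro: lpa_rels_A A_zero A_add A_smul A_mult\<close>)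

lemma kspan_eqv:
  assumes "x \<approx> y" "y \<in> kspan (Z \<union> I)" shows "x \<in> kspan (Z \<union> I)"
proof -
  have "x - y \<in> kspan (Z \<union> I)" using assms(1) by (intro kspan_superset) (simp add: eqv_def)
  from kspan.add[OF this assms(2)] show ?thesis by simp
qed

lemma kspan_eqv_mem:
  assumes "x \<approx> y" "y = 0 \<or> y \<in> Z" shows "x \<in> kspan (Z \<union> I)"
  using assms(2) by (intro kspan_eqv[OF assms(1)]) (auto intro: kspan_superset kspan.zero)

text \<open>One step of the derived series, computed on spanning sets modulo the ideal: products
  with a factor in the ideal stay there.\<close>

lemma jcirc_kspan:
  assumes X: "X \<subseteq> A" "Y \<subseteq> kspan (X \<union> I)"
    and XX: "\<And>x y. x \<in> X \<Longrightarrow> y \<in> X \<Longrightarrow> x * y + y * x \<in> kspan (Z \<union> I)"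
  shows "jcirc I Y Y \<subseteq> kspan (Z \<union> I)"
proof -
  have "a * b + b * a \<in> kspan (Z \<union> I)" if "a \<in> Y" "b \<in> Y" for a b
  proof (rule kspan_jordan_bilinear)
    show "a \<in> kspan (X \<union> I)" "b \<in> kspan (X \<union> I)" using that X by auto
    fix x y assume xy: "x \<in> X \<union> I" "y \<in> X \<union> I"
    then have "x \<in> A" "y \<in> A" using X(1) I_A by auto
    then have "x * y + y * x \<in> I" if "x \<in> I \<or> y \<in> I"
      using that by (auto intro: lpa_ideal.add A_I_mult_left A_I_mult_right)
    then show "x * y + y * x \<in> kspan (Z \<union> I)"
      using xy XX kspan_superset[of _ "Z \<union> I"] by blast
  qed
  then show ?thesis
    unfolding jcirc_def fmul_eq_times
    by (intro kspan_least) (auto intro: kspan_superset)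
qed

lemma kspan_I: "kspan I \<subseteq> I"
proof
  fix x assume "x \<in> kspan I"
  then show "x \<in> I" by induction (auto intro: lpa_ideal.intros)
qed

text \<open>A set of matrix entries: a monoid with unit x, commutative modulo the ideal. Sums are
  left to the spans taken later.\<close>

definition corner_ring :: "'v \<Rightarrow> ('v, 'e, 'k) falg set \<Rightarrow> bool" where
  "corner_ring x R \<longleftrightarrow> R \<subseteq> A \<and> gv x \<in> R \<and> (\<forall>a\<in>R. gv x * a \<approx> a \<and> a * gv x \<approx> a)
    \<and> (\<forall>a\<in>R. \<forall>b\<in>R. a * b \<in> R \<and> a * b \<approx> b * a)"

text \<open>\<open>R\<close> is the double centralizer of \<open>l\<close> and \<open>l'\<close> in the corner at \<open>x\<close>.\<close>
lemma commutative_corner: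
  assumes x: "x \<in> V" and l: "l \<in> A" "gv x * l \<approx> l" "l * gv x \<approx> l"
    and l': "l' \<in> A" "gv x * l' \<approx> l'" "l' * gv x \<approx> l'" and ll': "l * l' \<approx> l' * l"
  obtains R where "corner_ring x R" "l \<in> R" "l' \<in> R"
proof -
  define C where "C = {c \<in> A. gv x * c \<approx> c \<and> c * gv x \<approx> c \<and> l * c \<approx> c * l \<and> l' * c \<approx> c * l'}"
  define R where "R = {a \<in> A. gv x * a \<approx> a \<and> a * gv x \<approx> a \<and> (\<forall>c\<in>C. a * c \<approx> c * a)}"
  have vx: "gv x \<in> A" "gv x * gv x \<approx> gv x" using x gv_gv[of x x] A_gv by auto
  have "l \<in> R" "l' \<in> R" using l l' by (auto simp: R_def C_def)
  have "l \<in> C" "l' \<in> C" using l l' ll' by (auto simp: C_def eqv_refl A_mult intro: eqv_sym)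
  \<comment> \<open>An element of \<open>R\<close> commutes with all of \<open>C\<close>, in
    particular with l and l', and hence lies in \<open>C\<close>. This makes \<open>R\<close>
    commutative.\<close>
  then have RC: "R \<subseteq> C" by (auto simp: R_def C_def intro: eqv_sym)
  have "gv x \<in> R" using vx by (auto simp: R_def C_def intro: eqv_trans eqv_sym)
  have RR: "a * b \<in> R" if ab: "a \<in> R" "b \<in> R" for a b
  proof -
    have A: "a \<in> A" "b \<in> A" using ab by (auto simp: R_def)
    have "gv x * (a * b) \<approx> a * b"
      using eqv_mult_right[OF A(2), of "gv x * a" a] ab by (simp add: R_def mult.assoc)
    moreover have "a * b * gv x \<approx> a * b"
      using eqv_mult_left[OF A(1), of "b * gv x" b] ab by (simp add: R_def mult.assoc)
    moreover have "a * b * c \<approx> c * (a * b)" if c: "c \<in> C" for c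
    proof -
      have "a * b * c = a * (b * c)" by (simp add: mult.assoc)
      also have "\<dots> \<approx> a * (c * b)" using ab c by (intro eqv_mult_left A) (simp add: R_def)
      also have "a * (c * b) = a * c * b" by (simp add: mult.assoc)
      also have "\<dots> \<approx> c * a * b" using ab c by (intro eqv_mult_right A) (simp add: R_def)
      finally show ?thesis by (simp add: mult.assoc)
    qed
    ultimately show ?thesis using A by (auto simp: R_def A_mult)
  qed
  have comm: "a * b \<approx> b * a" if "a \<in> R" "b \<in> R" for a b
    using that RC unfolding R_def by blast
  have "R \<subseteq> A" "\<And>a. a \<in> R \<Longrightarrow> gv x * a \<approx> a \<and> a * gv x \<approx> a"
    unfolding R_def by blast+
  with RR comm \<open>gv x \<in> R\<close> have "corner_ring x R" unfolding corner_ring_def by blast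
  then show ?thesis by (rule that[OF _ \<open>l \<in> R\<close> \<open>l' \<in> R\<close>])
qed

end

locale sparse_lpa = lpa V Ed s r ty
  for V :: "'v set" and Ed :: "'e set" and s r :: "'e \<Rightarrow> 'v" and ty :: "'k::field itself" +
  assumes sparse: "sparse Ed s r"
begin

text \<open>The vertices indexing the matrix blocks: all vertices emitting only loops, and from each
  2-cycle one vertex, chosen by \<open>SOME\<close>.\<close>
definition X :: "'v set" where
  "X = {x \<in> V. \<forall>e\<in>Ed. s e = x \<longrightarrow> r e \<noteq> x \<longrightarrow>
      (\<exists>f\<in>Ed. s f = r e \<and> r f = x) \<and> (SOME y. y \<in> {x, r e}) = x}"

text \<open>Covers both the edge from a hub to x and, on a 2-cycle, the edge that enters x. By
  sparseness there is at most one.\<close>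

definition spoke :: "'v \<Rightarrow> 'e \<Rightarrow> bool" where
  "spoke x g \<longleftrightarrow> g \<in> Ed \<and> r g = x \<and> s g \<noteq> x"

definition p :: "'v \<Rightarrow> 'e" where "p x = (SOME g. spoke x g)"

text \<open>Row \<open>False\<close> belongs to the vertex x and row \<open>True\<close> to its
  spoke, so the block of x has size 1 or 2.\<close>

definition idx :: "'v \<Rightarrow> bool set" where "idx x = {i. i \<longrightarrow> spoke x (p x)}"

lemma spoke_p: "spoke x g \<Longrightarrow> p x = g"
proof -
  assume g: "spoke x g"
  then have "spoke x (p x)" unfolding p_def by (rule someI)
  with g show ?thesis
    using sparse_range[OF sparse, of "p x" g] by (simp add: spoke_def)
qed

lemma X_V: "x \<in> X \<Longrightarrow> x \<in> V" by (simp add: X_def)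

lemma X_D:
  assumes "e \<in> Ed" "s e \<in> X" "r e \<noteq> s e"
  shows "\<exists>f\<in>Ed. s f = r e \<and> r f = s e" "(SOME y. y \<in> {s e, r e}) = s e"
  using assms unfolding X_def by blast+

text \<open>If both x and s(g) were in \<open>X\<close>, they would form a 2-cycle, and
  \<open>SOME\<close> would choose both from the same unordered pair. This keeps distinct blocks
  orthogonal.\<close>

lemma spoke_source:
  assumes x: "x \<in> X" and g: "spoke x g" shows "s g \<notin> X"
proof
  assume a: "s g \<in> X"
  have g': "g \<in> Ed" "r g = x" "r g \<noteq> s g" using g by (auto simp: spoke_def)
  obtain f where f: "f \<in> Ed" "s f = r g" "r f = s g" using X_D(1)[OF g'(1) a g'(3)] by blast
  have "(SOME y. y \<in> {s g, x}) = s g" using X_D(2)[OF g'(1) a g'(3)] g'(2) by simp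
  moreover have "(SOME y. y \<in> {x, s g}) = x"
    using X_D(2)[OF f(1)] f x g' by metis
  ultimately show False using g' by (simp add: insert_commute)
qed

text \<open>If r(e) is not in \<open>X\<close>, it emits a nonloop edge, which by sparseness returns
  to s(e). Then e lies on a 2-cycle whose chosen vertex is s(e), and the returning edge is the
  spoke.\<close>

lemma nonloop_cases:
  assumes e: "e \<in> Ed" "s e \<noteq> r e"
  obtains "r e \<in> X" "p (r e) = e" "spoke (r e) e"
  | g where "s e \<in> X" "spoke (s e) g" "s g = r e" "p (s e) = g"
proof (cases "r e \<in> X")
  case True
  have "spoke (r e) e" using e by (simp add: spoke_def)
  with True show ?thesis using spoke_p that(1) by blast
next
  case False
  then obtain f where f: "f \<in> Ed" "s f = r e" "r f \<noteq> r e"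
    and nf: "\<not> ((\<exists>d\<in>Ed. s d = r f \<and> r d = r e) \<and> (SOME y. y \<in> {r e, r f}) = r e)"
    using r_in[OF e(1)] unfolding X_def by auto
  have rf: "r f = s e" using sparse_path[OF sparse e(1) f(1)] e f by simp
  then have "(SOME y. y \<in> {r e, s e}) \<noteq> r e" using nf e(1) by auto
  moreover have "(SOME y. y \<in> {r e, s e}) \<in> {r e, s e}" by (rule someI[of _ "r e"]) simp
  ultimately have choice: "(SOME y. y \<in> {s e, r e}) = s e" by (simp add: insert_commute)
  have "s e \<in> X"
    unfolding X_def
  proof (intro CollectI conjI ballI impI)
    show "s e \<in> V" using e s_in by simp
    fix d assume "d \<in> Ed" "s d = s e" "r d \<noteq> s e"
    then have "d = e" using two_cycle_out[OF sparse e f(1,2) rf] by simp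
    then show "\<exists>f\<in>Ed. s f = r d \<and> r f = s e" "(SOME y. y \<in> {s e, r d}) = s e"
      using f rf choice by auto
  qed
  moreover have "spoke (s e) f" using f rf e by (simp add: spoke_def)
  ultimately show ?thesis using that(2)[of f] f spoke_p by blast
qed

text \<open>What is needed to write the edges leaving x as matrices. The last clause concerns a
  2-cycle: with p the spoke, the edge f away from x is \<open>(f p) p^*\<close>, and its entry fp
  lies in the corner.\<close>

definition block_ring :: "'v \<Rightarrow> ('v, 'e, 'k) falg set \<Rightarrow> bool" where
  "block_ring x R \<longleftrightarrow> corner_ring x R
    \<and> (\<forall>k\<in>Ed. s k = x \<longrightarrow> r k = x \<longrightarrow> ge k \<in> R \<and> gs k \<in> R)
    \<and> (\<forall>f\<in>Ed. s f = x \<longrightarrow> r f \<noteq> x \<longrightarrow>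
        (\<exists>a\<in>R. ge f \<approx> a * gs (p x)) \<and> (\<exists>a\<in>R. gs f \<approx> ge (p x) * a))"

text \<open>The loop at x, or the cycle fg based at x, is invertible in the corner with its adjoint
  as inverse, because every vertex on it emits one edge. So it commutes with its adjoint. If x emits
  nothing, the vertex alone serves as generator.\<close>

lemma ex_block_ring:
  assumes x: "x \<in> X" shows "\<exists>R. block_ring x R"
proof -
  note V = X_V[OF x]
  consider (loop) k where "k \<in> Ed" "s k = x" "r k = x"
    | (cycle) f where "f \<in> Ed" "s f = x" "r f \<noteq> x"
    | (sink) "\<And>e. e \<in> Ed \<Longrightarrow> s e \<noteq> x" by blast
  then show ?thesis
  proof cases
    case loop
    have only: "f = k" if "f \<in> Ed" "s f = x" for f
      by (rule sparse_loop[OF sparse loop(1) that(1)]) (simp_all only: loop that)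
    have "ge k * gs k \<approx> gv x"
      using ge_gs[OF loop(1) only] unfolding loop(2) by blast
    moreover have "gs k * ge k \<approx> gv x" using gs_ge[of k k] loop by simp
    ultimately have comm: "ge k * gs k \<approx> gs k * ge k" by (blast intro: eqv_trans eqv_sym)
    obtain R where R: "corner_ring x R" "ge k \<in> R" "gs k \<in> R"
      using commutative_corner[OF V, of "ge k" "gs k"] comm s_ge[of k] ge_r[of k] r_gs[of k] gs_s[of k]
        loop A_ge A_gs by metis
    have "block_ring x R"
      unfolding block_ring_def
    proof (intro conjI ballI impI R(1))
      fix f assume f: "f \<in> Ed" "s f = x"
      note f = f only[OF f]
      show "ge f \<in> R" "gs f \<in> R" unfolding f(3) by (rule R)+
      assume "r f \<noteq> x"
      then have False using f(3) loop(3) by blast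
      then show "\<exists>a\<in>R. ge f \<approx> a * gs (p x)" "\<exists>a\<in>R. gs f \<approx> ge (p x) * a" by blast+
    qed
    then show ?thesis by blast
  next
    case cycle
    then obtain g where g: "g \<in> Ed" "s g = r f" "r g = s f" using X_D(1)[of f] x by auto
    have pg: "p x = g" using g cycle by (intro spoke_p) (simp add: spoke_def)
    have f: "s f \<noteq> r f" and g': "s g \<noteq> r g" using cycle g by auto
    have only_f: "d = f" if "d \<in> Ed" "s d = x" for d
      using two_cycle_out[OF sparse cycle(1) f g that(1)] cycle that by simp
    have only_g: "d = g" if "d \<in> Ed" "s d = r f" for d
      using two_cycle_out[OF sparse g(1) g' cycle(1) g(3)[symmetric] g(2)[symmetric] that(1)] that g by simp
    have A: "ge f \<in> A" "ge g \<in> A" "gs f \<in> A" "gs g \<in> A" "gv x \<in> A" "gv (r f) \<in> A"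
      using cycle g V r_in by (auto intro: A_gv A_ge A_gs)
    have ff: "ge f * gs f \<approx> gv x"
      using ge_gs[OF cycle(1) only_f] unfolding cycle(2) by blast
    have gg: "ge g * gs g \<approx> gv (r f)"
      using ge_gs[OF g(1) only_g] unfolding g(2) by blast
    have ff': "gs f * ge f \<approx> gv (r f)" using gs_ge[of f f] cycle by simp
    have gg': "gs g * ge g \<approx> gv x" using gs_ge[of g g] g cycle by simp
    let ?l = "ge f * ge g" and ?l' = "gs g * gs f"
    have "?l * ?l' = ge f * (ge g * gs g) * gs f" by (simp add: mult.assoc)
    also have "\<dots> \<approx> ge f * gv (r f) * gs f" by (intro eqv_mult_right eqv_mult_left A gg)
    also have "\<dots> \<approx> ge f * gs f" using ge_r[of f] cycle by (intro eqv_mult_right A) simp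
    also have "\<dots> \<approx> gv x" by (rule ff)
    finally have ll': "?l * ?l' \<approx> gv x" .
    have "?l' * ?l = gs g * (gs f * ge f) * ge g" by (simp add: mult.assoc)
    also have "\<dots> \<approx> gs g * gv (r f) * ge g" by (intro eqv_mult_right eqv_mult_left A ff')
    also have "\<dots> \<approx> gs g * ge g" using gs_s[of g] g by (intro eqv_mult_right A) simp
    also have "\<dots> \<approx> gv x" by (rule gg')
    finally have l'l: "?l' * ?l \<approx> gv x" .
    have lA: "?l \<in> A" "?l' \<in> A" using A by (auto intro: A_mult)
    have "gv x * ?l \<approx> ?l" "?l * gv x \<approx> ?l" "gv x * ?l' \<approx> ?l'" "?l' * gv x \<approx> ?l'"
      using eqv_mult_right[OF A(2) s_ge[OF cycle(1)]] eqv_mult_left[OF A(1) ge_r[OF g(1)]]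
        eqv_mult_right[OF A(3) r_gs[OF g(1)]] eqv_mult_left[OF A(4) gs_s[OF cycle(1)]] cycle g
      by (simp_all add: mult.assoc)
    with commutative_corner[OF V lA(1) _ _ lA(2)] eqv_trans[OF ll' eqv_sym[OF l'l]]
    obtain R where R: "corner_ring x R" "?l \<in> R" "?l' \<in> R"
      by metis
    have 1: "ge f \<approx> ?l * gs g"
    proof -
      have "?l * gs g = ge f * (ge g * gs g)" by (simp add: mult.assoc)
      also have "\<dots> \<approx> ge f * gv (r f)" by (intro eqv_mult_left A gg)
      also have "\<dots> \<approx> ge f" using ge_r cycle by simp
      finally show ?thesis by (rule eqv_sym)
    qed
    have 2: "gs f \<approx> ge g * ?l'"
    proof -
      have "ge g * ?l' = (ge g * gs g) * gs f" by (simp add: mult.assoc)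
      also have "\<dots> \<approx> gv (r f) * gs f" by (intro eqv_mult_right A gg)
      also have "\<dots> \<approx> gs f" using r_gs cycle by simp
      finally show ?thesis by (rule eqv_sym)
    qed
    have "block_ring x R"
      unfolding block_ring_def pg
    proof (intro conjI ballI impI R(1))
      fix d assume d: "d \<in> Ed" "s d = x"
      note d = d only_f[OF d]
      show "\<exists>a\<in>R. ge d \<approx> a * gs g" "\<exists>a\<in>R. gs d \<approx> ge g * a"
        unfolding d(3) using 1 2 R by blast+
      assume "r d = x"
      then have False using d(3) cycle(3) by blast
      then show "ge d \<in> R" "gs d \<in> R" by blast+
    qed
    then show ?thesis by blast
  next
    case sink
    have vv: "gv x * gv x \<approx> gv x" using gv_gv[OF V V] by simp
    obtain R where R: "corner_ring x R"
      using commutative_corner[OF V A_gv[OF V] vv vv A_gv[OF V] vv vv eqv_refl] A_mult A_gv V by metis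
    then have "block_ring x R" using sink unfolding block_ring_def by metis
    then show ?thesis by blast
  qed
qed

end

section \<open>Multiplication of matrix blocks\<close>

context sparse_lpa
begin

definition R :: "'v \<Rightarrow> ('v, 'e, 'k) falg set" where "R x = (SOME B. block_ring x B)"

lemma R: "x \<in> X \<Longrightarrow> block_ring x (R x)"
  unfolding R_def by (rule someI_ex[OF ex_block_ring])

lemma R_corner: "x \<in> X \<Longrightarrow> corner_ring x (R x)"
  using R by (simp add: block_ring_def)

lemma R_A: "x \<in> X \<Longrightarrow> a \<in> R x \<Longrightarrow> a \<in> A"
  and R_one: "x \<in> X \<Longrightarrow> gv x \<in> R x"
  and R_left: "x \<in> X \<Longrightarrow> a \<in> R x \<Longrightarrow> gv x * a \<approx> a"
  and R_right: "x \<in> X \<Longrightarrow> a \<in> R x \<Longrightarrow> a * gv x \<approx> a"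
  and R_mult: "x \<in> X \<Longrightarrow> a \<in> R x \<Longrightarrow> b \<in> R x \<Longrightarrow> a * b \<in> R x"
  and R_comm: "x \<in> X \<Longrightarrow> a \<in> R x \<Longrightarrow> b \<in> R x \<Longrightarrow> a * b \<approx> b * a"
  using R_corner[of x] unfolding corner_ring_def by blast+

definition al :: "'v \<Rightarrow> bool \<Rightarrow> ('v, 'e, 'k) falg" where
  "al x i = (if i then ge (p x) else gv x)"

definition al' :: "'v \<Rightarrow> bool \<Rightarrow> ('v, 'e, 'k) falg" where
  "al' x i = (if i then gs (p x) else gv x)"

text \<open>The matrix with single entry \<open>a\<close> at position (i, j) in the block of
  x.\<close>

definition mm :: "'v \<Rightarrow> bool \<Rightarrow> ('v, 'e, 'k) falg \<Rightarrow> bool \<Rightarrow> ('v, 'e, 'k) falg" where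
  "mm x i a j = al x i * a * al' x j"

lemma idx_False: "False \<in> idx x"
  by (simp add: idx_def)

lemma idx_spoke: "i \<in> idx x \<Longrightarrow> i \<Longrightarrow> spoke x (p x)"
  by (simp add: idx_def)

lemma p_source: "x \<in> X \<Longrightarrow> i \<in> idx x \<Longrightarrow> i \<Longrightarrow> s (p x) \<notin> X"
  using idx_spoke spoke_source by blast

lemma p_Ed: "i \<in> idx x \<Longrightarrow> i \<Longrightarrow> p x \<in> Ed" and p_range: "i \<in> idx x \<Longrightarrow> i \<Longrightarrow> r (p x) = x"
  using idx_spoke by (auto simp: spoke_def)

lemma al_A: "x \<in> X \<Longrightarrow> i \<in> idx x \<Longrightarrow> al x i \<in> A"
  and al'_A: "x \<in> X \<Longrightarrow> i \<in> idx x \<Longrightarrow> al' x i \<in> A"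
  using p_Ed[of i x] X_V[of x] by (auto simp: al_def al'_def intro: A_gv A_ge A_gs)

lemma mm_A: "x \<in> X \<Longrightarrow> i \<in> idx x \<Longrightarrow> j \<in> idx x \<Longrightarrow> a \<in> R x \<Longrightarrow> mm x i a j \<in> A"
  by (simp add: mm_def A_mult al_A al'_A R_A)

text \<open>For two spokes this is the relation on \<open>e^* f\<close>, as a spoke determines its
  range. A spoke against a vertex of \<open>X\<close> gives zero, since spokes start outside
  \<open>X\<close>.\<close>

lemma al'_al:
  assumes x: "x \<in> X" "j \<in> idx x" and y: "y \<in> X" "k \<in> idx y"
  shows "al' x j * al y k \<approx> (if x = y \<and> j = k then gv x else 0)"
proof -
  consider "\<not> j" "\<not> k" | "\<not> j" k | j "\<not> k" | j k by blast
  then show ?thesis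
  proof cases
    case 1
    then show ?thesis using gv_gv[OF X_V[OF x(1)] X_V[OF y(1)]] by (simp add: al_def al'_def)
  next
    case 2
    then have "x \<noteq> s (p y)" using p_source[OF y] x by blast
    then show ?thesis
      using 2 gv_ge[OF X_V[OF x(1)] p_Ed[OF y(2)]] by (simp add: al_def al'_def)
  next
    case 3
    then have "y \<noteq> s (p x)" using p_source[OF x] y by blast
    then show ?thesis
      using 3 gs_gv[OF X_V[OF y(1)] p_Ed[OF x(2)]] by (simp add: al_def al'_def)
  next
    case 4
    then have "p x = p y \<longleftrightarrow> x = y" using p_range[OF x(2)] p_range[OF y(2)] by metis
    then show ?thesis
      using 4 gs_ge[OF p_Ed[OF x(2)] p_Ed[OF y(2)]] p_range[OF x(2)]
      by (cases "x = y") (auto simp: al_def al'_def)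
  qed
qed

lemma mm_cong:
  "x \<in> X \<Longrightarrow> i \<in> idx x \<Longrightarrow> j \<in> idx x \<Longrightarrow> a \<approx> b \<Longrightarrow> mm x i a j \<approx> mm x i b j"
  unfolding mm_def by (intro eqv_mult_left eqv_mult_right al_A al'_A)

lemma mm_mult:
  assumes x: "x \<in> X" "i \<in> idx x" "j \<in> idx x" "a \<in> R x"
    and y: "y \<in> X" "k \<in> idx y" "l \<in> idx y" "b \<in> R y"
  shows "mm x i a j * mm y k b l \<approx> (if x = y \<and> j = k then mm x i (a * b) l else 0)"
proof -
  note A = al_A[OF x(1,2)] R_A[OF x(1,4)] al'_A[OF y(1,3)] R_A[OF y(1,4)]
  have "mm x i a j * mm y k b l = al x i * a * (al' x j * al y k) * b * al' y l"
    by (simp add: mm_def mult.assoc)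
  also have "\<dots> \<approx> al x i * a * (if x = y \<and> j = k then gv x else 0) * b * al' y l"
    by (intro eqv_mult_right eqv_mult_left A_mult A al'_al x y)
  also have "\<dots> \<approx> (if x = y \<and> j = k then mm x i (a * b) l else 0)"
  proof (cases "x = y \<and> j = k")
    case True
    have "al x i * a * gv x * b * al' x l = al x i * (a * gv x * b) * al' x l"
      by (simp add: mult.assoc)
    also have "\<dots> \<approx> al x i * (a * b) * al' x l"
      using A True by (intro eqv_mult_right eqv_mult_left R_right x) auto
    finally show ?thesis using True by (simp add: mm_def)
  qed (auto simp: eqv_refl A_zero)
  finally show ?thesis .
qed

text \<open>Outside \<open>X\<close> lie the hubs and the unchosen vertices of 2-cycles. Such a
  vertex differs from x, so it meets the block of x only in the row of a spoke that starts at
  it.\<close>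

lemma gv_mm:
  assumes w: "w \<in> V" "w \<notin> X" and x: "x \<in> X" "i \<in> idx x" "j \<in> idx x" "a \<in> R x"
  shows "gv w * mm x i a j \<approx> (if i \<and> w = s (p x) then mm x i a j else 0)"
proof -
  note A = al_A[OF x(1,2)] R_A[OF x(1,4)] al'_A[OF x(1,3)]
  have wx: "w \<noteq> x" using w x by blast
  have "gv w * al x i \<approx> (if i \<and> w = s (p x) then al x i else 0)"
  proof (cases i)
    case True
    then show ?thesis using gv_ge[OF w(1) p_Ed[OF x(2)]]
      by (cases "w = s (p x)") (auto simp: al_def)
  next
    case False
    then show ?thesis using gv_gv[OF w(1) X_V[OF x(1)]] wx by (simp add: al_def)
  qed
  then have "gv w * al x i * (a * al' x j) \<approx> (if i \<and> w = s (p x) then al x i else 0) * (a * al' x j)"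
    by (intro eqv_mult_right A_mult A)
  then show ?thesis
    by (cases "i \<and> w = s (p x)") (auto simp: mm_def mult.assoc)
qed

lemma mm_gv:
  assumes w: "w \<in> V" "w \<notin> X" and x: "x \<in> X" "i \<in> idx x" "j \<in> idx x" "a \<in> R x"
  shows "mm x i a j * gv w \<approx> (if j \<and> w = s (p x) then mm x i a j else 0)"
proof -
  note A = al_A[OF x(1,2)] R_A[OF x(1,4)] al'_A[OF x(1,3)]
  have wx: "x \<noteq> w" using w x by blast
  have "al' x j * gv w \<approx> (if j \<and> w = s (p x) then al' x j else 0)"
  proof (cases j)
    case True
    then show ?thesis using gs_gv[OF w(1) p_Ed[OF x(3)]]
      by (cases "w = s (p x)") (auto simp: al'_def)
  next
    case False
    then show ?thesis using gv_gv[OF X_V[OF x(1)] w(1)] wx by (simp add: al'_def)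
  qed
  then have "al x i * a * (al' x j * gv w) \<approx> al x i * a * (if j \<and> w = s (p x) then al' x j else 0)"
    by (intro eqv_mult_left A_mult A)
  then show ?thesis
    by (cases "j \<and> w = s (p x)") (auto simp: mm_def mult.assoc)
qed

section \<open>A spanning set closed under multiplication\<close>

definition mats :: "('v, 'e, 'k) falg set" where
  "mats = {mm x i a j | x i a j. x \<in> X \<and> i \<in> idx x \<and> j \<in> idx x \<and> a \<in> R x}"

text \<open>Vertices outside \<open>X\<close> are adjoined because the summation relation does not
  express a hub with infinitely many spokes through the blocks.\<close>

definition M :: "('v, 'e, 'k) falg set" where "M = mats \<union> gv ` (V - X)"

lemma M_A: "M \<subseteq> A"
  by (auto simp: M_def mats_def mm_A A_gv)

lemma M_cases [consumes 1, case_names mat hub]: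
  assumes "m \<in> M"
  obtains x i a j where "m = mm x i a j" "x \<in> X" "i \<in> idx x" "j \<in> idx x" "a \<in> R x"
    | w where "m = gv w" "w \<in> V" "w \<notin> X"
  using assms unfolding M_def mats_def by blast

lemma M_matI: "x \<in> X \<Longrightarrow> i \<in> idx x \<Longrightarrow> j \<in> idx x \<Longrightarrow> a \<in> R x \<Longrightarrow> mm x i a j \<in> M"
  unfolding M_def mats_def by blast

text \<open>Together with 0, the set \<open>M\<close> is a semigroup modulo the ideal, so words can
  be reduced letter by letter.\<close>

lemma M_mult:
  assumes "m \<in> M" "n \<in> M" shows "\<exists>c\<in>insert 0 M. m * n \<approx> c"
  using assms(1)
proof (cases rule: M_cases)
  case m: (mat x i a j)
  from assms(2) show ?thesis
  proof (cases rule: M_cases)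
    case n: (mat y k b l)
    have "(if x = y \<and> j = k then mm x i (a * b) l else 0) \<in> insert 0 M"
      using m n by (auto intro!: M_matI R_mult)
    then show ?thesis
      using mm_mult[OF m(2-5) n(2-5)] unfolding m(1) n(1) by blast
  next
    case n: (hub w)
    have "(if j \<and> w = s (p x) then mm x i a j else 0) \<in> insert 0 M"
      using m n by (auto intro!: M_matI)
    then show ?thesis
      using mm_gv[OF n(2,3) m(2-5)] unfolding m(1) n(1) by blast
  qed
next
  case m: (hub w)
  from assms(2) show ?thesis
  proof (cases rule: M_cases)
    case n: (mat y k b l)
    have "(if k \<and> w = s (p y) then mm y k b l else 0) \<in> insert 0 M"
      using m n by (auto intro!: M_matI)
    then show ?thesis
      using gv_mm[OF m(2,3) n(2-5)] unfolding m(1) n(1) by blast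
  next
    case n: (hub w')
    have "(if w = w' then gv w else 0) \<in> insert 0 M" using m assms by auto
    then show ?thesis using gv_gv[OF m(2) n(2)] unfolding m(1) n(1) by blast
  qed
qed

lemma block_unit_eqv: "x \<in> X \<Longrightarrow> a \<in> R x \<Longrightarrow> a \<approx> mm x False a False"
proof -
  assume x: "x \<in> X" "a \<in> R x"
  have "gv x * a * gv x \<approx> a * gv x" by (intro eqv_mult_right R_left A_gv X_V x)
  also have "\<dots> \<approx> a" by (rule R_right[OF x])
  finally show ?thesis by (simp add: mm_def al_def al'_def eqv_sym)
qed

text \<open>A loop is an entry at (False, False), a spoke at (True, False), and the edge opposite to
  the spoke of a 2-cycle at (False, True). Adjoints sit at the transposed positions.\<close>

lemma edge_M:
  assumes e: "e \<in> Ed" shows "\<exists>m\<in>M. ge e \<approx> m" "\<exists>m\<in>M. gs e \<approx> m"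
proof -
  have "(\<exists>m\<in>M. ge e \<approx> m) \<and> (\<exists>m\<in>M. gs e \<approx> m)"
  proof (cases "s e = r e")
    case True
    have x: "s e \<in> X"
      unfolding X_def
    proof (intro CollectI conjI ballI impI)
      show "s e \<in> V" using s_in e by simp
      fix d assume d: "d \<in> Ed" "s d = s e" "r d \<noteq> s e"
      then have False using sparse_loop[OF sparse e d(1) True d(2)] True by simp
      then show "\<exists>f\<in>Ed. s f = r d \<and> r f = s e" "(SOME y. y \<in> {s e, r d}) = s e" by blast+
    qed
    then have "ge e \<in> R (s e)" "gs e \<in> R (s e)"
      using R[OF x] e True unfolding block_ring_def by auto
    then show ?thesis using block_unit_eqv[OF x] M_matI[OF x idx_False idx_False] by blast
  next
    case False
    show ?thesis
    proof (cases rule: nonloop_cases[OF e False])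
      case spoke: 1
      then have i: "True \<in> idx (r e)" by (simp add: idx_def)
      have v: "gv (r e) \<in> A" using A_gv r_in e by simp
      have "ge e * gv (r e) * gv (r e) \<approx> ge e" "gv (r e) * gv (r e) * gs e \<approx> gs e"
        using eqv_trans[OF eqv_mult_right[OF v ge_r[OF e]] ge_r[OF e]]
          eqv_trans[OF eqv_mult_left[OF v r_gs[OF e]] r_gs[OF e]] by (simp_all add: mult.assoc)
      then have "ge e \<approx> mm (r e) True (gv (r e)) False" "gs e \<approx> mm (r e) False (gv (r e)) True"
        by (simp_all add: mm_def al_def al'_def spoke eqv_sym)
      then show ?thesis
        using M_matI[OF spoke(1) i idx_False R_one[OF spoke(1)]]
          M_matI[OF spoke(1) idx_False i R_one[OF spoke(1)]] by blast
    next
      case return: (2 g)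
      have i: "True \<in> idx (s e)" using return by (simp add: idx_def)
      have g: "g \<in> Ed" using return by (simp add: spoke_def)
      obtain a b where ab: "a \<in> R (s e)" "b \<in> R (s e)" "ge e \<approx> a * gs g" "gs e \<approx> ge g * b"
        using R[OF return(1)] e False return(4) unfolding block_ring_def by metis
      have "gv (s e) * a * gs g \<approx> a * gs g" "ge g * b * gv (s e) \<approx> ge g * b"
        using eqv_mult_right[OF A_gs[OF g] R_left[OF return(1) ab(1)]]
          eqv_mult_left[OF A_ge[OF g] R_right[OF return(1) ab(2)]] by (simp_all add: mult.assoc)
      then have "ge e \<approx> mm (s e) False a True" "gs e \<approx> mm (s e) True b False"
        using ab(3,4) by (auto simp: mm_def al_def al'_def return(4) intro: eqv_trans eqv_sym)
      then show ?thesis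
        using M_matI[OF return(1) idx_False i ab(1)] M_matI[OF return(1) i idx_False ab(2)] by blast
    qed
  qed
  then show "\<exists>m\<in>M. ge e \<approx> m" "\<exists>m\<in>M. gs e \<approx> m" by blast+
qed

lemma gen_M: "g \<in> gens V Ed \<Longrightarrow> \<exists>m\<in>M. gen1 g \<approx> m"
proof -
  assume "g \<in> gens V Ed"
  then consider v where "g = GV v" "v \<in> V" | e where "g = GE e" "e \<in> Ed" | e where "g = GS e" "e \<in> Ed"
    unfolding gens_def by blast
  then show ?thesis
  proof cases
    case 1
    show ?thesis
    proof (cases "v \<in> X")
      case True
      then show ?thesis
        using block_unit_eqv[OF True R_one] M_matI[OF True idx_False idx_False R_one] unfolding 1(1) by blast
    next
      case False
      then show ?thesis using 1 eqv_refl[OF A_gv] by (auto simp: M_def)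
    qed
  qed (use edge_M in auto)
qed

lemma wd_M:
  assumes "set w \<subseteq> gens V Ed" "w \<noteq> []" shows "\<exists>m\<in>insert 0 M. wd w \<approx> m"
  using assms(2,1)
proof (induction w rule: list_nonempty_induct)
  case (single g)
  then show ?case using gen_M[of g] by (auto simp: wd_single)
next
  case (cons g w)
  obtain m n where mn: "m \<in> M" "gen1 g \<approx> m" "n \<in> insert 0 M" "wd w \<approx> n"
    using cons gen_M[of g] by auto
  have prod: "wd (g # w) \<approx> m * n" using mn cons(1) by (simp add: wd_Cons eqv_mult)
  show ?case
  proof (cases "n = 0")
    case False
    with mn obtain c where "c \<in> insert 0 M" "m * n \<approx> c" using M_mult by blast
    with prod show ?thesis using eqv_trans by blast
  qed (use prod in auto)
qed

lemma free_alg_M: "free_alg V Ed \<subseteq> kspan (M \<union> I)"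
proof
  fix q :: "('v, 'e, 'k) falg" assume q: "q \<in> free_alg V Ed"
  have mem: "Poly_Mapping.single w c \<in> kspan (M \<union> I)" if "w \<in> Poly_Mapping.keys q" for w c
  proof -
    have "set w \<subseteq> gens V Ed" "w \<noteq> []" using q that by (auto simp: free_alg_def)
    then obtain m where "m = 0 \<or> m \<in> M" "wd w \<approx> m" using wd_M by blast
    then have "wd w \<in> kspan (M \<union> I)" by (metis kspan_eqv_mem)
    then have "smul c (wd w) \<in> kspan (M \<union> I)" by (rule kspan_smul)
    then show ?thesis by (simp add: wd_def smul_single)
  qed
  have "(\<Sum>w\<in>B. Poly_Mapping.single w (Poly_Mapping.lookup q w)) \<in> kspan (M \<union> I)"
    if "finite B" "B \<subseteq> Poly_Mapping.keys q" for B
    using that by (induction B rule: finite_induct) (auto intro: kspan.zero kspan.add mem)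
  from this[of "Poly_Mapping.keys q"] show "q \<in> kspan (M \<union> I)"
    by (simp add: sum_single_lookup)
qed

lemma sym_M: "S \<subseteq> kspan (M \<union> I)"
  using free_alg_M by (auto simp: lpa_sym_def)

end

section \<open>Characteristic two\<close>

locale sparse_lpa_2 = sparse_lpa V Ed s r ty
  for V :: "'v set" and Ed :: "'e set" and s r :: "'e \<Rightarrow> 'v" and ty :: "'k::field itself" +
  assumes char2: "CHAR('k) = 2"
begin

lemma double_zero: "(a :: ('v, 'e, 'k) falg) + a = 0"
proof -
  have "(2::'k) = 0" using of_nat_CHAR[where ?'a = 'k] char2 by simp
  then have "c + c = 0" for c :: 'k by (metis mult_2 mult_zero_left)
  then show ?thesis by (intro poly_mapping_eqI) (simp add: lookup_add)
qed

text \<open>Commutativity of the entries puts the same \<open>a * b\<close> into both terms; the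
  cancellations below depend on it.\<close>

lemma mm_bracket:
  assumes x: "x \<in> X" "i \<in> idx x" "j \<in> idx x" "a \<in> R x"
    and y: "y \<in> X" "k \<in> idx y" "l \<in> idx y" "b \<in> R y"
  shows "mm x i a j * mm y k b l + mm y k b l * mm x i a j
    \<approx> (if x = y \<and> j = k then mm x i (a * b) l else 0) + (if x = y \<and> l = i then mm x k (a * b) j else 0)"
proof (intro eqv_add mm_mult x y)
  show "mm y k b l * mm x i a j \<approx> (if x = y \<and> l = i then mm x k (a * b) j else 0)"
  proof (cases "x = y \<and> l = i")
    case True
    have "mm y k b l * mm x i a j \<approx> mm x k (b * a) j"
      using mm_mult[OF y x] True by auto
    also have "\<dots> \<approx> mm x k (a * b) j"
      using True x y by (intro mm_cong R_comm) auto
    finally show ?thesis using True by simp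
  qed (use mm_mult[OF y x] in auto)
qed

text \<open>A scalar 2 by 2 matrix, which in characteristic 2 has trace zero.\<close>

definition dd :: "'v \<Rightarrow> ('v, 'e, 'k) falg \<Rightarrow> ('v, 'e, 'k) falg" where
  "dd x a = mm x False a False + mm x True a True"

definition diags :: "('v, 'e, 'k) falg set" where
  "diags = {dd x a | x a. x \<in> X \<and> True \<in> idx x \<and> a \<in> R x}"

definition offs :: "('v, 'e, 'k) falg set" where
  "offs = {mm x i a (\<not> i) | x i a. x \<in> X \<and> True \<in> idx x \<and> a \<in> R x}"

lemma idx_True: "True \<in> idx x \<Longrightarrow> i \<in> idx x"
  by (cases i) (auto simp: idx_def)

lemma mm_bracket_mem:
  assumes x: "x \<in> X" "i \<in> idx x" "j \<in> idx x" "a \<in> R x"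
    and y: "y \<in> X" "k \<in> idx y" "l \<in> idx y" "b \<in> R y"
  shows "mm x i a j * mm y k b l + mm y k b l * mm x i a j \<in> kspan ((diags \<union> offs) \<union> I)"
proof (rule kspan_eqv_mem[OF mm_bracket[OF x y]])
  show "(if x = y \<and> j = k then mm x i (a * b) l else 0) + (if x = y \<and> l = i then mm x k (a * b) j else 0) = 0
    \<or> (if x = y \<and> j = k then mm x i (a * b) l else 0) + (if x = y \<and> l = i then mm x k (a * b) j else 0)
      \<in> diags \<union> offs"
  proof (cases "x = y")
    case True
    have ab: "a * b \<in> R x" using x y True by (simp add: R_mult)
    have off: "mm x u (a * b) v \<in> offs" if "u \<noteq> v" "u \<in> idx x" "v \<in> idx x" for u v
    proof -
      have "True \<in> idx x" "v = (\<not> u)" using that by (cases u; auto)+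
      then show ?thesis using x(1) ab unfolding offs_def by blast
    qed
    have diag: "mm x u (a * b) u + mm x v (a * b) v \<in> diags" if "u \<noteq> v" "u \<in> idx x" "v \<in> idx x" for u v
    proof -
      have "True \<in> idx x" "mm x u (a * b) u + mm x v (a * b) v = dd x (a * b)"
        using that by (cases u; auto simp: dd_def add.commute)+
      then show ?thesis using x(1) ab unfolding diags_def by blast
    qed
    \<comment> \<open>If just one of the two conditions holds, its term is off-diagonal. If both
      hold, the terms sit at (i, i) and (k, k), and they cancel for i = k or form a scalar matrix
      otherwise.\<close>
    show ?thesis
      using off[of i l] off[of k j] diag[of i k] x y True double_zero
      by (cases "j = k"; cases "l = i"; cases "i = k") auto
  qed simp
qed

lemma M_bracket:
  assumes "m \<in> M" "n \<in> M" shows "m * n + n * m \<in> kspan ((diags \<union> offs) \<union> I)"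
proof -
  have hub: "mm x i a j * gv w + gv w * mm x i a j \<in> kspan ((diags \<union> offs) \<union> I)"
    if x: "x \<in> X" "i \<in> idx x" "j \<in> idx x" "a \<in> R x" and w: "w \<in> V" "w \<notin> X" for x i j a w
  proof (rule kspan_eqv_mem[OF eqv_add[OF mm_gv[OF w x] gv_mm[OF w x]]])
    \<comment> \<open>For i = j the left and right products agree and cancel; otherwise only the
      index \<open>True\<close> can contribute.\<close>
    have "mm x i a j \<in> offs" if "i \<noteq> j"
    proof -
      have "True \<in> idx x" "j = (\<not> i)" using that x by (cases i; auto)+
      then show ?thesis using x unfolding offs_def by blast
    qed
    then show "(if j \<and> w = s (p x) then mm x i a j else 0) + (if i \<and> w = s (p x) then mm x i a j else 0) = 0
      \<or> (if j \<and> w = s (p x) then mm x i a j else 0) + (if i \<and> w = s (p x) then mm x i a j else 0)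
        \<in> diags \<union> offs"
      using double_zero by (cases "i = j") auto
  qed
  from assms(1) show ?thesis
  proof (cases rule: M_cases)
    case m: (mat x i a j)
    from assms(2) show ?thesis
    proof (cases rule: M_cases)
      case n: (mat y k b l)
      show ?thesis unfolding m(1) n(1) by (rule mm_bracket_mem[OF m(2-5) n(2-5)])
    next
      case n: (hub w)
      show ?thesis unfolding m(1) n(1) by (rule hub[OF m(2-5) n(2-3)])
    qed
  next
    case m: (hub w)
    from assms(2) show ?thesis
    proof (cases rule: M_cases)
      case n: (mat y k b l)
      show ?thesis unfolding m(1) n(1) using hub[OF n(2-5) m(2-3)] by (simp add: add.commute)
    next
      case n: (hub w')
      have "gv w * gv w' + gv w' * gv w \<approx> (if w = w' then gv w else 0) + (if w' = w then gv w' else 0)"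
        by (intro eqv_add gv_gv m n)
      then show ?thesis unfolding m(1) n(1)
        by (rule kspan_eqv_mem) (simp add: double_zero)
    qed
  qed
qed

text \<open>A scalar matrix is central in its block and annihilates the others, so in characteristic
  2 its Jordan products vanish.\<close>

lemma dd_mm:
  assumes x: "x \<in> X" "True \<in> idx x" "a \<in> R x" and y: "y \<in> X" "k \<in> idx y" "l \<in> idx y" "b \<in> R y"
  shows "dd x a * mm y k b l + mm y k b l * dd x a \<approx> 0"
proof -
  let ?E = "\<lambda>i. mm x i a i"
  let ?c = "\<lambda>i. (if x = y \<and> i = k then mm x i (a * b) l else 0)
    + (if x = y \<and> l = i then mm x k (a * b) i else 0)"
  have br: "?E i * mm y k b l + mm y k b l * ?E i \<approx> ?c i" for i
    by (rule mm_bracket[OF x(1) idx_True[OF x(2)] idx_True[OF x(2)] x(3) y])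
  have "?c False + ?c True = 0"
    by (cases "x = y"; cases k; cases l) (simp_all add: double_zero)
  moreover have "dd x a * mm y k b l + mm y k b l * dd x a
      = (?E False * mm y k b l + mm y k b l * ?E False) + (?E True * mm y k b l + mm y k b l * ?E True)"
    by (simp add: dd_def algebra_simps)
  ultimately show ?thesis using eqv_add[OF br[of False] br[of True]] by metis
qed

lemma dd_dd:
  assumes x: "x \<in> X" "True \<in> idx x" "a \<in> R x" and y: "y \<in> X" "True \<in> idx y" "b \<in> R y"
  shows "dd x a * dd y b + dd y b * dd x a \<approx> 0"
proof -
  note y' = y(1) idx_True[OF y(2)] idx_True[OF y(2)] y(3)
  have "dd x a * dd y b + dd y b * dd x a
     = (dd x a * mm y False b False + mm y False b False * dd x a)
     + (dd x a * mm y True b True + mm y True b True * dd x a)"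
    by (simp add: dd_def[of y] algebra_simps)
  also have "\<dots> \<approx> 0 + 0"
    by (intro eqv_add dd_mm x y')
  finally show ?thesis by simp
qed

lemma diags_commute: "m \<in> diags \<Longrightarrow> n \<in> diags \<Longrightarrow> m * n + n * m \<approx> 0"
  unfolding diags_def using dd_dd by blast

text \<open>Entries at opposite positions give the same \<open>a * b\<close> at both diagonal
  places, a scalar matrix; entries at equal positions give zero.\<close>

lemma off_off:
  assumes x: "x \<in> X" "True \<in> idx x" "a \<in> R x" and y: "y \<in> X" "True \<in> idx y" "b \<in> R y"
  shows "mm x i a (\<not> i) * mm y k b (\<not> k) + mm y k b (\<not> k) * mm x i a (\<not> i) \<in> kspan (diags \<union> I)"
proof (rule kspan_eqv_mem[OF mm_bracket])
  show "(if x = y \<and> (\<not> i) = k then mm x i (a * b) (\<not> k) else 0)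
      + (if x = y \<and> (\<not> k) = i then mm x k (a * b) (\<not> i) else 0) = 0
    \<or> (if x = y \<and> (\<not> i) = k then mm x i (a * b) (\<not> k) else 0)
      + (if x = y \<and> (\<not> k) = i then mm x k (a * b) (\<not> i) else 0) \<in> diags"
  proof (cases "x = y \<and> k = (\<not> i)")
    case True
    then have "mm x i (a * b) i + mm x (\<not> i) (a * b) (\<not> i) = dd x (a * b)"
      by (cases i) (auto simp: dd_def add.commute)
    moreover have "dd x (a * b) \<in> diags" using x y True R_mult unfolding diags_def by blast
    ultimately show ?thesis using True by simp
  qed auto
qed (use x y idx_True in auto)

lemma diags_offs_bracket:
  assumes "m \<in> diags \<union> offs" "n \<in> diags \<union> offs"
  shows "m * n + n * m \<in> kspan (diags \<union> I)"
proof -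
  have mixed: "d * u + u * d \<in> kspan (diags \<union> I)" if d: "d \<in> diags" and u: "u \<in> offs" for d u
  proof -
    obtain x a where x: "d = dd x a" "x \<in> X" "True \<in> idx x" "a \<in> R x"
      using d unfolding diags_def by blast
    obtain y k b where y: "u = mm y k b (\<not> k)" "y \<in> X" "True \<in> idx y" "b \<in> R y"
      using u unfolding offs_def by blast
    show ?thesis unfolding x(1) y(1)
      by (rule kspan_eqv_mem[OF dd_mm[OF x(2-4) y(2) idx_True[OF y(3)] idx_True[OF y(3)] y(4)]]) simp
  qed
  from assms consider "m \<in> diags" "n \<in> diags" | "m \<in> diags" "n \<in> offs"
    | "m \<in> offs" "n \<in> diags" | "m \<in> offs" "n \<in> offs" by blast
  then show ?thesis
  proof cases
    case 1
    then show ?thesis by (intro kspan_eqv_mem[OF diags_commute]) auto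
  next
    case 2
    then show ?thesis by (rule mixed)
  next
    case 3
    then show ?thesis using mixed[of n m] by (simp add: add.commute)
  next
    case 4
    then show ?thesis unfolding offs_def using off_off by blast
  qed
qed

lemma sparse_solvable: "lpa_sym_jordan_solvable V Ed s r TYPE('k)"
proof -
  have A: "diags \<subseteq> A" "offs \<subseteq> A"
    unfolding diags_def offs_def dd_def using mm_A idx_True by (blast intro: A_add)+
  \<comment> \<open>The derived series passes from all matrices to trace zero, then to scalars, then
    to zero.\<close>
  have 1: "jderived I S 1 \<subseteq> kspan ((diags \<union> offs) \<union> I)"
    using jcirc_kspan[OF M_A sym_M M_bracket] by simp
  have 2: "jderived I S (Suc 1) \<subseteq> kspan (diags \<union> I)"
    using jcirc_kspan[OF _ 1 diags_offs_bracket] A by simp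
  have "m * n + n * m \<in> kspan ({} \<union> I)" if "m \<in> diags" "n \<in> diags" for m n
    by (rule kspan_eqv_mem[OF diags_commute[OF that]]) simp
  from jcirc_kspan[OF A(1) 2 this] have "jderived I S (Suc (Suc 1)) \<subseteq> kspan ({} \<union> I)" by simp
  then have "jderived I S (Suc (Suc 1)) \<subseteq> I" using kspan_I by auto
  then show ?thesis unfolding lpa_sym_jordan_solvable_def by blast
qed

text \<open>Without nonloop edges every vertex is in \<open>X\<close> and no spokes exist. All
  blocks have size 1, so the algebra is commutative and its Jordan products vanish in characteristic
  2.\<close>

lemma loops_nilpotent:
  assumes loops: "\<And>e. e \<in> Ed \<Longrightarrow> s e = r e"
  shows "lpa_sym_jordan_nilpotent V Ed s r TYPE('k)"
proof -
  have "X = V" using loops by (auto simp: X_def)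
  then have M: "M = mats" by (simp add: M_def)
  have idx: "i \<in> idx x \<Longrightarrow> \<not> i" for i x
    using loops by (auto simp: idx_def spoke_def)
  have "m * n + n * m \<in> kspan ({} \<union> I)" if "m \<in> mats" "n \<in> mats" for m n
  proof -
    obtain x i a j where m: "m = mm x i a j" "x \<in> X" "i \<in> idx x" "j \<in> idx x" "a \<in> R x"
      using \<open>m \<in> mats\<close> unfolding mats_def by blast
    obtain y k b l where n: "n = mm y k b l" "y \<in> X" "k \<in> idx y" "l \<in> idx y" "b \<in> R y"
      using \<open>n \<in> mats\<close> unfolding mats_def by blast
    have "\<not> i" "\<not> j" "\<not> k" "\<not> l" using idx m n by blast+
    then show ?thesis
      unfolding m(1) n(1)
      by (intro kspan_eqv_mem[OF mm_bracket[OF m(2-5) n(2-5)]]) (simp add: double_zero)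
  qed
  then have "jcirc I S S \<subseteq> kspan ({} \<union> I)"
    using jcirc_kspan[OF M_A sym_M] unfolding M by blast
  then have "jlower I S 1 \<subseteq> I" using kspan_I by auto
  then show ?thesis unfolding lpa_sym_jordan_nilpotent_def by blast
qed

end

theorem theorem4p13:
  fixes V :: "'v set" and Ed :: "'e set" and s r :: "'e \<Rightarrow> 'v"
  assumes "graph V Ed s r"
  shows "(CHAR('k::field) = 2 \<longrightarrow>
            (lpa_sym_jordan_solvable V Ed s r TYPE('k) \<longleftrightarrow> union_E1_to_E6 V Ed s r) \<and>
            (lpa_sym_jordan_nilpotent V Ed s r TYPE('k) \<longleftrightarrow> union_E1_E2 V Ed s r))
       \<and> (CHAR('k) \<noteq> 2 \<and> V \<noteq> {} \<longrightarrow> \<not> lpa_sym_jordan_nilpotent V Ed s r TYPE('k))"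
proof -
  interpret lpa V Ed s r "TYPE('k)" using assms by unfold_locales
  have sparse_iff: "union_E1_to_E6 V Ed s r \<longleftrightarrow> sparse Ed s r"
    using union_sparse[OF assms] sparse_union[OF assms] by blast
  \<comment> \<open>Once all edges are loops, only the third clause of \<open>sparse\<close> has
    content, and two loops at one vertex are excluded by \<open>loop_obstruction\<close>.\<close>
  have nilpotent_sparse: "sparse Ed s r \<and> (\<forall>e\<in>Ed. s e = r e)"
    if nil: "lpa_sym_jordan_nilpotent V Ed s r TYPE('k)"
  proof -
    have loops: "s e = r e" if "e \<in> Ed" for e using nonloop_not_nilpotent[OF that] nil by blast
    moreover have "f = e" if "e \<in> Ed" "f \<in> Ed" "s f = s e" for e f
      using loop_obstruction(2)[OF that(1,2) loops[OF that(1)] that(3)] nil by blast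
    ultimately show ?thesis unfolding sparse_def by (intro conjI ballI impI; blast)
  qed
  show ?thesis
  proof (intro conjI impI)
    assume char2: "CHAR('k) = 2"
    have sp: "sparse_lpa_2 TYPE('k) V Ed s r" if "sparse Ed s r"
      using that char2 by unfold_locales
    show "lpa_sym_jordan_solvable V Ed s r TYPE('k) \<longleftrightarrow> union_E1_to_E6 V Ed s r"
      unfolding sparse_iff using solvable_sparse sparse_lpa_2.sparse_solvable[OF sp] by blast
    show "lpa_sym_jordan_nilpotent V Ed s r TYPE('k) \<longleftrightarrow> union_E1_E2 V Ed s r"
      unfolding union_E1_E2_iff[OF assms]
      using nilpotent_sparse sparse_lpa_2.loops_nilpotent[OF sp] by blast
  next
    assume "CHAR('k) \<noteq> 2 \<and> V \<noteq> {}"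
    then show "\<not> lpa_sym_jordan_nilpotent V Ed s r TYPE('k)"
      using char_not_2_not_nilpotent by blast
  qed
qed

end
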